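(* Let $n,d\ge1$ be integers, let $w\colon G\to[0,\infty)$ be a measurable function on an open set $G\subset\mathbb{R}^n$, let $\mu$ be a probability measure on $G$ satisfying the weighted Poincaré-type inequality with weight $w$, and let $f\colon G\to\mathbb{R}$ be a $\mathcal{C}^d$-smooth function with $\int_G f\,d\mu=0$. Then, for any $p\ge 2$, \begin{align*} \lVert f\rVert_p&\le\sum_{k=1}^{d-1}\big(2^{\frac{k-2}{2}}p\,\lVert w\rVert_{2^kp}\big)^k\,\lVert f^{(k)}\rVert_{\mathrm{Op},2}+\big(2^{\frac{d-2}{2}}p\big)^d\,\lVert w\rVert_{2^{d-1}p}^{d-1}\,\big\lVert w\,|f^{(d)}|_{\mathrm{Op}}\big\rVert_{2^{d-1}p}\\ &\le\sum_{k=1}^{d-1}\big(2^{\frac{k-2}{2}}p\,\lVert w\rVert_{2^kp}\big)^k\,\lVert f^{(k)}\rVert_{\mathrm{Op},2}+\big(2^{\frac{d-2}{2}}p\,\lVert w\rVert_{2^dp}\big)^d\,\lVert f^{(d)}\rVert_{\mathrm{Op},2^dp}. \end{align*}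
   Context: A Borel probability measure $\mu$ on an open set $G\subset\mathbb{R}^n$ satisfies a weighted Poincaré-type inequality with (measurable) weight $w\colon G\to[0,\infty)$ if for every bounded smooth function $g$ on $G$ with gradient $\nabla g$, $\mathrm{Var}_\mu(g)\le\int|\nabla g|^2w^2\,d\mu$, where $\mathrm{Var}_\mu(g)=\int g^2\,d\mu-(\int g\,d\mu)^2$ and $|\cdot|$ is the Euclidean norm. For $q>0$ and a measurable function $g$ on $G$, $\lVert g\rVert_q=\big(\int_G|g|^q\,d\mu\big)^{1/q}\in[0,\infty]$. For $f\in\mathcal{C}^d(G)$ and $1\le k\le d$, $f^{(k)}(x)$ is the (hyper-)matrix with entries $f^{(k)}_{i_1\ldots i_k}(x)=\partial_{i_1\ldots i_k}f(x)$, regarded as a symmetric multilinear $k$-form, and its operator norm is $|f^{(k)}(x)|_{\mathrm{Op}}=\sup\{f^{(k)}(x)[v_1,\ldots,v_k]\colon v_i\in\mathbb{R}^n,\ |v_1|=\cdots=|v_k|=1\}$. For $q\in(0,\infty)$, $\lVert f^{(k)}\rVert_{\mathrm{Op},q}=\big(\int_G|f^{(k)}|_{\mathrm{Op}}^q\,d\mu\big)^{1/q}\in[0,\infty]$.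
   Formalization: "Smooth" in the weighted Poincaré-type inequality is taken as continuously differentiable: it is assumed for all bounded C^1 functions g. With C^∞ test functions only, the claim fails for d=1, n=2 (measure on Whitney's arc, weight w with w^2 non-integrable on every subarc). *)

theory Defs
  imports "HOL-Analysis.Analysis" "HOL-Probability.Probability"
begin

definition partial_deriv :: "'n::finite \<Rightarrow> (real ^ 'n \<Rightarrow> real) \<Rightarrow> real ^ 'n \<Rightarrow> real" where
  "partial_deriv i f x = deriv (\<lambda>t. f (x + t *\<^sub>R axis i 1)) 0"

text \<open>For an index list \<open>[i1, \<dots>, ik]\<close> the iterated derivative is
  \<open>\<partial>i1 (\<partial>i2 (\<dots> (\<partial>ik f)))\<close>.\<close>

fun iter_partial :: "'n::finite list \<Rightarrow> (real ^ 'n \<Rightarrow> real) \<Rightarrow> real ^ 'n \<Rightarrow> real" where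
  "iter_partial [] f = f"
| "iter_partial (i # is) f = partial_deriv i (iter_partial is f)"

text \<open>\<open>f\<close> is of class \<open>C^d\<close> on the open set \<open>G\<close>: all partial derivatives of order at most \<open>d\<close>
  exist and are continuous on \<open>G\<close>. As \<open>G\<close> is open, the values of \<open>f\<close> outside \<open>G\<close> are irrelevant.\<close>

definition Cd_on :: "nat \<Rightarrow> (real ^ 'n::finite) set \<Rightarrow> (real ^ 'n \<Rightarrow> real) \<Rightarrow> bool" where
  "Cd_on d G f \<longleftrightarrow>
     (\<forall>is. length is \<le> d \<longrightarrow> continuous_on G (iter_partial is f)) \<and>
     (\<forall>is i x. length is < d \<longrightarrow> x \<in> G \<longrightarrow>
        (\<lambda>t. iter_partial is f (x + t *\<^sub>R axis i 1)) field_differentiable (at 0))"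

definition gradient :: "(real ^ 'n::finite \<Rightarrow> real) \<Rightarrow> real ^ 'n \<Rightarrow> real ^ 'n" where
  "gradient f x = (\<chi> i. partial_deriv i f x)"

text \<open>The \<open>k\<close>-linear form with coefficients \<open>\<partial>_{i1 \<dots> ik} f(x)\<close>, evaluated at
  \<open>v 0, \<dots>, v (k - 1)\<close>.\<close>

definition deriv_form ::
    "nat \<Rightarrow> (real ^ 'n::finite \<Rightarrow> real) \<Rightarrow> real ^ 'n \<Rightarrow> (nat \<Rightarrow> real ^ 'n) \<Rightarrow> real" where
  "deriv_form k f x v =
     (\<Sum>is \<in> {is :: 'n list. length is = k}. iter_partial is f x * (\<Prod>j<k. v j $ (is ! j)))"

text \<open>For \<open>k \<ge> 1\<close>. The supremum is over a nonempty set that is bounded above, so it is a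
  genuine real supremum.\<close>

definition deriv_op_norm :: "nat \<Rightarrow> (real ^ 'n::finite \<Rightarrow> real) \<Rightarrow> real ^ 'n \<Rightarrow> real" where
  "deriv_op_norm k f x = (SUP v \<in> {v. \<forall>j<k. norm (v j) = 1}. deriv_form k f x v)"

definition ennreal_powr :: "ennreal \<Rightarrow> real \<Rightarrow> ennreal" where
  "ennreal_powr x q = (if x = \<infinity> then \<infinity> else ennreal (enn2real x powr q))"

text \<open>The norm with exponent \<open>q > 0\<close>, with values in \<open>[0, \<infinity>]\<close>. In products of such values, the
  convention of \<open>ennreal\<close> is \<open>0 * \<infinity> = 0\<close>, and \<open>a ^ 0 = 1\<close> also for \<open>a = \<infinity>\<close>.\<close>

definition Lq_norm :: "'a measure \<Rightarrow> real \<Rightarrow> ('a \<Rightarrow> real) \<Rightarrow> ennreal" where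
  "Lq_norm M q g = ennreal_powr (\<integral>\<^sup>+ x. ennreal (\<bar>g x\<bar> powr q) \<partial>M) (1 / q)"

definition Var :: "'a measure \<Rightarrow> ('a \<Rightarrow> real) \<Rightarrow> real" where
  "Var M g = (\<integral>x. (g x)\<^sup>2 \<partial>M) - (\<integral>x. g x \<partial>M)\<^sup>2"

text \<open>The test functions are the bounded functions that are smooth in the sense of being
  continuously differentiable. This matters because the weight may be arbitrarily irregular.
  With \<open>C^\<infinity>\<close> test functions only, the inequality need not pass to \<open>C^1\<close> functions: let \<open>\<mu>\<close> be a
  nonatomic measure of full support on an arc in the plane along which some \<open>C^1\<close> function is
  critical but not constant (Whitney), and let \<open>w\<close> be finite with \<open>w\<^sup>2\<close> not integrable on any
  subarc. The right-hand side is then infinite for every smooth \<open>g\<close> that is not critical along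
  the whole arc, and all others are constant on it by Sard's theorem; but for Whitney's function
  the right-hand side is \<open>0\<close> and the variance is positive.\<close>

definition weighted_poincare ::
    "(real ^ 'n::finite) set \<Rightarrow> (real ^ 'n) measure \<Rightarrow> (real ^ 'n \<Rightarrow> real) \<Rightarrow> bool" where
  "weighted_poincare G \<mu> w \<longleftrightarrow>
     (\<forall>g. Cd_on 1 G g \<longrightarrow> bounded (g ` G) \<longrightarrow>
        ennreal (Var \<mu> g) \<le> (\<integral>\<^sup>+ x. ennreal ((norm (gradient g x))\<^sup>2 * (w x)\<^sup>2) \<partial>\<mu>))"

end

(* For a bounded C^1 function g, the Poincare inequality is applied in one variable to the
   antisymmetric function T (g x - g y), where T u = sgn u * |u| powr (p/2).  For an
   antisymmetric h on the product space, E h^2 is at most twice the average variance of its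
   sections, and Young's inequality then gives
   ||g(x) - g(y)||_p <= p / sqrt 2 * || w |grad g| ||_p on the product.  Truncation removes the
   boundedness of g, and Jensen's inequality in y turns the left-hand side into ||g - E g||_p.

   The operator norm of the k-th derivative is only locally Lipschitz, while the Poincare
   inequality is assumed for C^1 functions alone.  It is the limit of the C^1 functions
   1/N * ln (1/N * sum_{j<N} cosh (N * F_j)), where F_j is the derivative form evaluated at the
   j-th element of a countable dense family of tuples of unit vectors: their gradients are
   combinations of the gradients of the F_j with weights of total mass at most 1, hence
   bounded by the operator norm of the (k+1)-st derivative.  So
   ||f^(k)||_q <= ||f^(k)||_2 + q / sqrt 2 * ||w |f^(k+1)| ||_q, and the theorem follows by
   iterating this with q = 2^k p, using Cauchy-Schwarz to split off the weight. *)
theory Submission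
  imports Defs "HOL-Real_Asymp.Real_Asymp"
begin

section \<open>\<open>L\<^sup>q\<close> norms\<close>

lemma ennreal_powr_ennreal: "0 \<le> x \<Longrightarrow> ennreal_powr (ennreal x) q = ennreal (x powr q)"
  by (simp add: ennreal_powr_def)

lemma ennreal_powr_top [simp]: "ennreal_powr \<infinity> q = \<infinity>" "ennreal_powr top q = top"
  by (simp_all add: ennreal_powr_def)

lemma ennreal_powr_mono:
  assumes "x \<le> y" "0 \<le> q"
  shows "ennreal_powr x q \<le> ennreal_powr y q"
proof (cases y)
  case (real b)
  with assms(1) obtain a where "x = ennreal a" "0 \<le> a" by (cases x) (auto simp: top_unique)
  with real assms show ?thesis
    by (auto simp: ennreal_powr_ennreal intro!: ennreal_leI powr_mono2)
qed (auto simp: ennreal_powr_def)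

lemma ennreal_powr_mult:
  assumes "0 < q"
  shows "ennreal_powr (x * y) q = ennreal_powr x q * ennreal_powr y q"
proof (cases x; cases y)
  fix a b assume "x = ennreal a" "0 \<le> a" "y = ennreal b" "0 \<le> b"
  then show ?thesis
    by (simp add: ennreal_powr_ennreal powr_mult flip: ennreal_mult)
next
  fix a assume "x = ennreal a" "0 \<le> a" "y = top"
  then show ?thesis
    by (cases "a = 0") (auto simp: ennreal_powr_def ennreal_mult_top)
next
  fix b assume "x = top" "y = ennreal b" "0 \<le> b"
  then show ?thesis
    by (cases "b = 0") (auto simp: ennreal_powr_def ennreal_top_mult)
next
  assume "x = top" "y = top"
  then show ?thesis by (simp add: ennreal_powr_def)
qed

lemma ennreal_powr_powr:
  "ennreal_powr (ennreal_powr x a) b = ennreal_powr x (a * b)"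
  by (cases x) (auto simp: ennreal_powr_ennreal powr_powr ennreal_powr_def)

section \<open>Norm bounds as integral bounds, Cauchy-Schwarz and Fatou\<close>

lemma Lq_norm_le_iff:
  assumes "0 < q" "0 \<le> c"
  shows "Lq_norm M q g \<le> ennreal c \<longleftrightarrow> (\<integral>\<^sup>+x. ennreal (\<bar>g x\<bar> powr q) \<partial>M) \<le> ennreal (c powr q)"
    (is "?L \<longleftrightarrow> ?I \<le> _")
proof
  assume "?L"
  then have "ennreal_powr (Lq_norm M q g) q \<le> ennreal_powr (ennreal c) q"
    using assms by (intro ennreal_powr_mono) auto
  moreover have "ennreal_powr (Lq_norm M q g) q = ?I"
    using assms unfolding Lq_norm_def ennreal_powr_powr
    by (cases ?I) (auto simp: ennreal_powr_ennreal)
  ultimately show "?I \<le> ennreal (c powr q)"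
    using assms by (simp add: ennreal_powr_ennreal)
next
  assume "?I \<le> ennreal (c powr q)"
  then have "Lq_norm M q g \<le> ennreal_powr (ennreal (c powr q)) (1 / q)"
    using assms unfolding Lq_norm_def by (intro ennreal_powr_mono) auto
  then show ?L
    using assms by (simp add: ennreal_powr_ennreal powr_powr)
qed

lemma Lq_norm_mono:
  assumes "0 < q" "\<And>x. x \<in> space M \<Longrightarrow> \<bar>g x\<bar> \<le> \<bar>h x\<bar>"
  shows "Lq_norm M q g \<le> Lq_norm M q h"
  unfolding Lq_norm_def using assms
  by (intro ennreal_powr_mono nn_integral_mono ennreal_leI powr_mono2) auto

text \<open>Cauchy-Schwarz for |u|^q and |v|^q, followed by a root of order 2q. It splits the weight
  off from a derivative at the price of doubling the exponent.\<close>

lemma Lq_norm_mult_le: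
  assumes [measurable]: "u \<in> borel_measurable M" "v \<in> borel_measurable M" and q: "0 < q"
  shows "Lq_norm M q (\<lambda>x. u x * v x) \<le> Lq_norm M (2 * q) u * Lq_norm M (2 * q) v"
proof -
  have sq: "ennreal (\<bar>t\<bar> powr q) ^ 2 = ennreal (\<bar>t\<bar> powr (2 * q))" for t :: real
    by (simp add: power2_eq_square powr_add[symmetric] flip: ennreal_mult)
  have "(\<integral>\<^sup>+x. ennreal (\<bar>u x * v x\<bar> powr q) \<partial>M)\<^sup>2
      = (\<integral>\<^sup>+x. ennreal (\<bar>u x\<bar> powr q) * ennreal (\<bar>v x\<bar> powr q) \<partial>M)\<^sup>2"
    by (simp add: abs_mult powr_mult flip: ennreal_mult)
  also have "\<dots> \<le> (\<integral>\<^sup>+x. ennreal (\<bar>u x\<bar> powr q) ^ 2 \<partial>M) * (\<integral>\<^sup>+x. ennreal (\<bar>v x\<bar> powr q) ^ 2 \<partial>M)"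
    by (rule Cauchy_Schwarz_nn_integral) measurable
  finally have "ennreal_powr ((\<integral>\<^sup>+x. ennreal (\<bar>u x * v x\<bar> powr q) \<partial>M)\<^sup>2) (1 / (2 * q))
      \<le> ennreal_powr ((\<integral>\<^sup>+x. ennreal (\<bar>u x\<bar> powr (2 * q)) \<partial>M)
          * (\<integral>\<^sup>+x. ennreal (\<bar>v x\<bar> powr (2 * q)) \<partial>M)) (1 / (2 * q))"
    using q unfolding sq by (intro ennreal_powr_mono) auto
  moreover have "ennreal_powr (y\<^sup>2) (1 / (2 * q)) = ennreal_powr y (1 / q)" for y
  proof (cases y)
    case (real a)
    then have "(a\<^sup>2) powr (1 / (2 * q)) = a powr (1 / q)"
      using q by (simp add: powr_powr flip: powr_numeral) 
    then show ?thesis using real by (simp add: ennreal_powr_ennreal ennreal_power)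
  qed auto
  ultimately show ?thesis
    using q by (simp add: Lq_norm_def ennreal_powr_mult)
qed

lemma (in prob_space) Lq_norm_const: "0 < q \<Longrightarrow> Lq_norm M q (\<lambda>x. c) = ennreal \<bar>c\<bar>"
  by (simp add: Lq_norm_def emeasure_space_1 ennreal_powr_ennreal powr_powr)

lemma (in prob_space) Lq_norm_le_double:
  assumes [measurable]: "u \<in> borel_measurable M" and "0 < q"
  shows "Lq_norm M q u \<le> Lq_norm M (2 * q) u"
  using Lq_norm_mult_le[of u M "\<lambda>x. 1" q] assms(2) by (simp add: Lq_norm_const)

text \<open>Exponents only ever grow by doubling here, so iterating Cauchy-Schwarz against the
  constant 1 suffices.\<close>

lemma (in prob_space) Lq_norm_dyadic_mono:
  assumes [measurable]: "u \<in> borel_measurable M" and p: "0 < p" and "j \<le> k"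
  shows "Lq_norm M (2 ^ j * p) u \<le> Lq_norm M (2 ^ k * p) u"
  using \<open>j \<le> k\<close>
proof (induction rule: dec_induct)
  case (step k)
  have "Lq_norm M (2 ^ k * p) u \<le> Lq_norm M (2 ^ Suc k * p) u"
    using Lq_norm_le_double[of u "2 ^ k * p"] p by (simp add: mult.assoc)
  with step.IH show ?case by (rule order.trans)
qed simp

text \<open>Fatou's lemma for q-th powers. No domination is required, so it serves both for removing
  the truncation and for reaching the operator norm from its approximants.\<close>

lemma Lq_norm_Fatou:
  assumes [measurable]: "\<And>n::nat. u n \<in> borel_measurable M"
    and lim: "\<And>x. x \<in> space M \<Longrightarrow> (\<lambda>n. u n x) \<longlonglongrightarrow> v x"
    and q: "0 < q" and le: "\<And>n. Lq_norm M q (u n) \<le> C"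
  shows "Lq_norm M q v \<le> C"
proof (cases C)
  case (real c)
  have *: "(\<integral>\<^sup>+x. ennreal (\<bar>u n x\<bar> powr q) \<partial>M) \<le> ennreal (c powr q)" for n
    using Lq_norm_le_iff[OF q, of c M "u n"] le real by simp
  have "(\<integral>\<^sup>+x. ennreal (\<bar>v x\<bar> powr q) \<partial>M)
      = (\<integral>\<^sup>+x. liminf (\<lambda>n. ennreal (\<bar>u n x\<bar> powr q)) \<partial>M)"
  proof (rule nn_integral_cong)
    fix x assume x: "x \<in> space M"
    have "(\<lambda>n. ennreal (\<bar>u n x\<bar> powr q)) \<longlonglongrightarrow> ennreal (\<bar>v x\<bar> powr q)"
      using q by (intro tendsto_ennrealI tendsto_powr' tendsto_rabs lim x tendsto_const) auto
    then show "ennreal (\<bar>v x\<bar> powr q) = liminf (\<lambda>n. ennreal (\<bar>u n x\<bar> powr q))"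
      using lim_imp_Liminf[OF trivial_limit_sequentially] by metis
  qed
  also have "\<dots> \<le> liminf (\<lambda>n. \<integral>\<^sup>+x. ennreal (\<bar>u n x\<bar> powr q) \<partial>M)"
    by (rule nn_integral_liminf) measurable
  also have "\<dots> \<le> ennreal (c powr q)"
    by (rule Liminf_le) (use * in auto)
  finally show ?thesis using Lq_norm_le_iff[OF q, of c M v] real by simp
qed simp

section \<open>Convexity of powers: Minkowski and Jensen\<close>

text \<open>The tangent line of t^q at m, rearranged as Young's inequality with exponents q and q/(q
  - 1). Convexity, Jensen's inequality and the moment estimate below all come from it.\<close>

lemma powr_Young:
  fixes s m q :: real
  assumes "0 \<le> s" "0 \<le> m" "1 \<le> q"
  shows "m powr (q - 1) * s \<le> s powr q / q + (1 - 1 / q) * m powr q"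
proof (cases "q = 1")
  case True
  then show ?thesis using assms by auto
next
  case False
  with assms have q: "1 < q" by simp
  have "s * m powr (q - 1) \<le> s powr q / q + (m powr (q - 1)) powr (q / (q - 1)) / (q / (q - 1))"
    using q assms by (intro Youngs_inequality) (auto simp: field_simps)
  also have "(m powr (q - 1)) powr (q / (q - 1)) = m powr q"
    using q by (simp add: powr_powr)
  finally show ?thesis using q by (simp add: field_simps)
qed

lemma powr_convex_comb:
  fixes s t q :: real
  assumes "0 \<le> s" "0 \<le> t" "1 \<le> q" "0 \<le> a" "0 \<le> b" "a + b = 1"
  shows "(a * s + b * t) powr q \<le> a * s powr q + b * t powr q"
proof -
  \<comment> \<open>The tangent inequality is taken at the mean \<open>m\<close> for both
    \<open>s\<close> and \<open>t\<close>; averaged, it leaves (1 - 1/q) m^q, which is absorbed on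
    the left.\<close>
  define m where "m = a * s + b * t"
  have m: "0 \<le> m" using assms by (simp add: m_def)
  have "m powr q = m powr (q - 1) * m"
    using m by (cases "m = 0") (auto simp: powr_diff)
  also have "\<dots> = a * (m powr (q - 1) * s) + b * (m powr (q - 1) * t)"
    by (subst (2) m_def) (simp add: algebra_simps)
  also have "\<dots> \<le> a * (s powr q / q + (1 - 1 / q) * m powr q) + b * (t powr q / q + (1 - 1 / q) * m powr q)"
    using assms m by (intro add_mono mult_left_mono powr_Young) auto
  also have "\<dots> = (a * s powr q + b * t powr q) / q + (a + b) * ((1 - 1 / q) * m powr q)"
    by (simp add: algebra_simps add_divide_distrib)
  finally have "m powr q \<le> (a * s powr q + b * t powr q) / q + (1 - 1 / q) * m powr q"
    using assms by simp
  then have "m powr q / q \<le> (a * s powr q + b * t powr q) / q"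
    by (simp add: algebra_simps)
  then show ?thesis
    using assms by (simp add: m_def field_simps)
qed

lemma Lq_norm_triangle:
  assumes [measurable]: "u \<in> borel_measurable M" "v \<in> borel_measurable M" and q: "1 \<le> q"
  shows "Lq_norm M q (\<lambda>x. u x + v x) \<le> Lq_norm M q u + Lq_norm M q v"
proof (rule ennreal_le_epsilon)
  fix e :: real assume e: "0 < e" and fin: "Lq_norm M q u + Lq_norm M q v < top"
  then obtain a b where ab: "Lq_norm M q u = ennreal a" "Lq_norm M q v = ennreal b" "0 \<le> a" "0 \<le> b"
    by (cases "Lq_norm M q u"; cases "Lq_norm M q v") auto
  \<comment> \<open>The extra e/2 keeps both normalising constants positive even when a norm is
    0.\<close>
  define A where "A = a + e / 2"
  define B where "B = b + e / 2"
  have AB: "0 < A" "0 < B" "0 < A + B" using ab e by (auto simp: A_def B_def)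
  have "Lq_norm M q u \<le> ennreal A" "Lq_norm M q v \<le> ennreal B"
    using ab e by (auto simp: A_def B_def intro!: ennreal_leI)
  then have I: "(\<integral>\<^sup>+x. ennreal (\<bar>u x\<bar> powr q) \<partial>M) \<le> ennreal (A powr q)"
      "(\<integral>\<^sup>+x. ennreal (\<bar>v x\<bar> powr q) \<partial>M) \<le> ennreal (B powr q)"
    using AB q by (simp_all add: Lq_norm_le_iff)
  \<comment> \<open>Convexity is applied to |u|/A and |v|/B with weights A/(A + B) and B/(A + B).
    The constants are collected so that \<open>\<alpha> * A powr q + \<beta> * B powr q\<close> is
    (A + B)^q.\<close>
  define \<alpha> where "\<alpha> = (A + B) powr q * (A / (A + B)) / A powr q"
  define \<beta> where "\<beta> = (A + B) powr q * (B / (A + B)) / B powr q"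
  have ge0: "0 \<le> \<alpha>" "0 \<le> \<beta>" using AB by (auto simp: \<alpha>_def \<beta>_def)
  have pt: "\<bar>u x + v x\<bar> powr q \<le> \<alpha> * \<bar>u x\<bar> powr q + \<beta> * \<bar>v x\<bar> powr q" for x
  proof -
    have "\<bar>u x + v x\<bar> powr q \<le> (\<bar>u x\<bar> + \<bar>v x\<bar>) powr q"
      using q by (intro powr_mono2) auto
    also have "\<bar>u x\<bar> + \<bar>v x\<bar>
        = (A + B) * (A / (A + B) * (\<bar>u x\<bar> / A) + B / (A + B) * (\<bar>v x\<bar> / B))"
      using AB by (simp add: distrib_left)
    also have "\<dots> powr q = (A + B) powr q * (A / (A + B) * (\<bar>u x\<bar> / A) + B / (A + B) * (\<bar>v x\<bar> / B)) powr q"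
      by (rule powr_mult)
    also have "\<dots> \<le> (A + B) powr q * (A / (A + B) * (\<bar>u x\<bar> / A) powr q + B / (A + B) * (\<bar>v x\<bar> / B) powr q)"
      using AB q by (intro mult_left_mono powr_convex_comb) (auto simp: add_divide_distrib[symmetric])
    also have "\<dots> = \<alpha> * \<bar>u x\<bar> powr q + \<beta> * \<bar>v x\<bar> powr q"
      using AB by (simp add: \<alpha>_def \<beta>_def powr_divide field_simps)
    finally show ?thesis .
  qed
  have "(\<integral>\<^sup>+x. ennreal (\<bar>u x + v x\<bar> powr q) \<partial>M)
      \<le> (\<integral>\<^sup>+x. ennreal \<alpha> * ennreal (\<bar>u x\<bar> powr q) + ennreal \<beta> * ennreal (\<bar>v x\<bar> powr q) \<partial>M)"
    using pt ge0 by (intro nn_integral_mono) (auto simp flip: ennreal_mult ennreal_plus intro!: ennreal_leI)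
  also have "\<dots> = ennreal \<alpha> * (\<integral>\<^sup>+x. ennreal (\<bar>u x\<bar> powr q) \<partial>M)
      + ennreal \<beta> * (\<integral>\<^sup>+x. ennreal (\<bar>v x\<bar> powr q) \<partial>M)"
    by (simp add: nn_integral_add nn_integral_cmult)
  also have "\<dots> \<le> ennreal \<alpha> * ennreal (A powr q) + ennreal \<beta> * ennreal (B powr q)"
    using I by (intro add_mono mult_left_mono) auto
  also have "\<dots> = ennreal (\<alpha> * A powr q + \<beta> * B powr q)"
    using ge0 by (simp flip: ennreal_mult ennreal_plus)
  also have "\<alpha> * A powr q + \<beta> * B powr q = (A + B) powr q * (A / (A + B) + B / (A + B))"
    using AB by (simp add: \<alpha>_def \<beta>_def distrib_left)
  also have "A / (A + B) + B / (A + B) = 1"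
    using AB by (simp add: add_divide_distrib[symmetric])
  finally have "Lq_norm M q (\<lambda>x. u x + v x) \<le> ennreal (A + B)"
    using AB q by (subst Lq_norm_le_iff) auto
  also have "\<dots> = Lq_norm M q u + Lq_norm M q v + ennreal e"
    using ab e by (simp add: A_def B_def flip: ennreal_plus)
  finally show "Lq_norm M q (\<lambda>x. u x + v x) \<le> Lq_norm M q u + Lq_norm M q v + ennreal e" .
qed

text \<open>Jensen's inequality, by integrating the tangent bound for |u|^q at c = |E u| and using c
  <= E |u|.\<close>

lemma (in prob_space) powr_abs_expectation_le:
  assumes u: "integrable M u" and q: "1 \<le> q"
  shows "ennreal (\<bar>\<integral>x. u x \<partial>M\<bar> powr q) \<le> (\<integral>\<^sup>+x. ennreal (\<bar>u x\<bar> powr q) \<partial>M)"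
proof (cases "\<integral>\<^sup>+x. ennreal (\<bar>u x\<bar> powr q) \<partial>M")
  case (real X)
  have [measurable]: "u \<in> borel_measurable M" using u by auto
  define c where "c = \<bar>\<integral>x. u x \<partial>M\<bar>"
  have c: "0 \<le> c" "c \<le> (\<integral>x. \<bar>u x\<bar> \<partial>M)" using u by (auto simp: c_def)
  have int: "integrable M (\<lambda>x. \<bar>u x\<bar> powr q)"
    by (rule integrableI_nonneg) (use real in auto)
  then have X: "X = (\<integral>x. \<bar>u x\<bar> powr q \<partial>M)"
    using nn_integral_eq_integral[OF int] real by (simp add: integral_nonneg)
  have "c powr q = c powr (q - 1) * c"
    using c by (cases "c = 0") (auto simp: powr_diff)
  also have "\<dots> \<le> c powr (q - 1) * (\<integral>x. \<bar>u x\<bar> \<partial>M)"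
    using c by (intro mult_left_mono) auto
  also have "\<dots> = (\<integral>x. c powr (q - 1) * \<bar>u x\<bar> \<partial>M)" by simp
  also have "\<dots> \<le> (\<integral>x. \<bar>u x\<bar> powr q / q + (1 - 1 / q) * c powr q \<partial>M)"
    using u int c q by (intro integral_mono powr_Young) auto
  also have "\<dots> = X / q + (1 - 1 / q) * c powr q"
    using int by (simp add: X prob_space)
  finally have "c powr q \<le> X"
    using q by (simp add: field_simps)
  then show ?thesis using real by (simp add: c_def ennreal_leI)
qed simp

text \<open>For fixed x, g x - E g is the mean over y of g x - g y, so Jensen's inequality applies
  in y.\<close>

lemma (in prob_space) Lq_norm_centered_le:
  assumes g: "integrable M g" and q: "1 \<le> q"
  shows "Lq_norm M q (\<lambda>x. g x - (\<integral>y. g y \<partial>M)) \<le> Lq_norm (M \<Otimes>\<^sub>M M) q (\<lambda>(x, y). g x - g y)"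
proof -
  have [measurable]: "g \<in> borel_measurable M" using g by auto
  have "(\<integral>\<^sup>+x. ennreal (\<bar>g x - (\<integral>y. g y \<partial>M)\<bar> powr q) \<partial>M)
      \<le> (\<integral>\<^sup>+x. \<integral>\<^sup>+y. ennreal (\<bar>g x - g y\<bar> powr q) \<partial>M \<partial>M)"
  proof (rule nn_integral_mono)
    fix x assume "x \<in> space M"
    have "integrable M (\<lambda>y. g x - g y)" using g by simp
    from powr_abs_expectation_le[OF this q] g
    show "ennreal (\<bar>g x - (\<integral>y. g y \<partial>M)\<bar> powr q) \<le> (\<integral>\<^sup>+y. ennreal (\<bar>g x - g y\<bar> powr q) \<partial>M)"
      by (simp add: prob_space)
  qed
  also have "\<dots> = (\<integral>\<^sup>+z. ennreal (\<bar>(\<lambda>(x, y). g x - g y) z\<bar> powr q) \<partial>(M \<Otimes>\<^sub>M M))"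
    by (subst nn_integral_fst[symmetric]) auto
  finally show ?thesis
    using q unfolding Lq_norm_def by (intro ennreal_powr_mono) auto
qed

section \<open>Moments of functions under a weighted Poincare inequality\<close>

text \<open>By antisymmetry the two one-variable projections of h are m(x) and -m(y), each of second
  moment b. Subtracting both from h leaves a square of nonnegative mean, so E h^2 >= 2 b, whereas
  the average variance of the sections is E h^2 - b; hence the factor 2.\<close>

lemma (in prob_space) antisymmetric_variance:
  fixes h :: "'a \<times> 'a \<Rightarrow> real"
  assumes [measurable]: "h \<in> borel_measurable (M \<Otimes>\<^sub>M M)"
    and bnd: "\<And>x y. x \<in> space M \<Longrightarrow> y \<in> space M \<Longrightarrow> \<bar>h (x, y)\<bar> \<le> B"
    and anti: "\<And>x y. x \<in> space M \<Longrightarrow> y \<in> space M \<Longrightarrow> h (x, y) = - h (y, x)"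
  shows "(\<integral>z. (h z)\<^sup>2 \<partial>(M \<Otimes>\<^sub>M M)) \<le> 2 * (\<integral>y. Var M (\<lambda>x. h (y, x)) \<partial>M)"
proof -
  define m where "m = (\<lambda>y. \<integral>x. h (y, x) \<partial>M)"
  have [measurable]: "m \<in> borel_measurable M" unfolding m_def by measurable
  interpret Q: pair_prob_space M M ..
  obtain x0 where "x0 \<in> space M" using not_empty by auto
  with bnd[of x0 x0] have B: "0 \<le> B" by linarith
  have mB: "\<bar>m y\<bar> \<le> B" if y: "y \<in> space M" for y
  proof (cases "integrable M (\<lambda>x. h (y, x))")
    case True
    then have "\<bar>m y\<bar> \<le> (\<integral>x. \<bar>h (y, x)\<bar> \<partial>M)" by (simp add: m_def)
    also have "\<dots> \<le> (\<integral>x. B \<partial>M)" using True bnd y by (intro integral_mono) auto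
    finally show ?thesis by (simp add: prob_space)
  next
    \<comment> \<open>The Bochner integral then has the default value 0, which is within the
      bound.\<close>
    case False
    then show ?thesis using B by (simp add: m_def not_integrable_integral_eq)
  qed
  have int: "integrable (M \<Otimes>\<^sub>M M) F"
    if "F \<in> borel_measurable (M \<Otimes>\<^sub>M M)" "\<And>z. z \<in> space (M \<Otimes>\<^sub>M M) \<Longrightarrow> \<bar>F z\<bar> \<le> B * B" for F :: "'a \<times> 'a \<Rightarrow> real"
    using that by (intro Q.P.integrable_const_bound[of _ "B * B"]) auto
  have prodB: "\<bar>a * b\<bar> \<le> B * B" if "\<bar>a\<bar> \<le> B" "\<bar>b\<bar> \<le> B" for a b
    using that B by (auto simp: abs_mult intro!: mult_mono)
  note I = int[OF _ prodB]
  have i1: "integrable (M \<Otimes>\<^sub>M M) (\<lambda>z. h z * h z)" using bnd by (intro I) (auto simp: space_pair_measure)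
  have i2: "integrable (M \<Otimes>\<^sub>M M) (\<lambda>z. m (fst z) * m (fst z))" using mB by (intro I) (auto simp: space_pair_measure)
  have i3: "integrable (M \<Otimes>\<^sub>M M) (\<lambda>z. m (snd z) * m (snd z))" using mB by (intro I) (auto simp: space_pair_measure)
  have i4: "integrable (M \<Otimes>\<^sub>M M) (\<lambda>z. h z * m (fst z))" using bnd mB by (intro I) (auto simp: space_pair_measure)
  have i5: "integrable (M \<Otimes>\<^sub>M M) (\<lambda>z. h z * m (snd z))" using bnd mB by (intro I) (auto simp: space_pair_measure)
  have i6: "integrable (M \<Otimes>\<^sub>M M) (\<lambda>z. m (fst z) * m (snd z))" using mB by (intro I) (auto simp: space_pair_measure)
  define b where "b = (\<integral>y. m y * m y \<partial>M)"
  have e2: "(\<integral>z. m (fst z) * m (fst z) \<partial>(M \<Otimes>\<^sub>M M)) = b"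
    using Q.integral_fst'[OF i2] by (simp add: b_def prob_space)
  have e3: "(\<integral>z. m (snd z) * m (snd z) \<partial>(M \<Otimes>\<^sub>M M)) = b"
    using Q.integral_fst'[OF i3] by (simp add: b_def prob_space)
  have e4: "(\<integral>z. h z * m (fst z) \<partial>(M \<Otimes>\<^sub>M M)) = b"
    using Q.integral_fst'[OF i4] by (simp add: b_def m_def)
  \<comment> \<open>Swapping the two coordinates turns this into the previous integral; antisymmetry
    of h supplies the sign.\<close>
  have "(\<integral>z. h z * m (snd z) \<partial>(M \<Otimes>\<^sub>M M)) = (\<integral>z. h (prod.swap z) * m (fst z) \<partial>(M \<Otimes>\<^sub>M M))"
    using Q.integral_product_swap[of "\<lambda>z. h z * m (snd z)"]
    by (simp add: case_prod_unfold prod.swap_def)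
  also have "\<dots> = (\<integral>z. - (h z * m (fst z)) \<partial>(M \<Otimes>\<^sub>M M))"
  proof (intro Bochner_Integration.integral_cong refl)
    fix z assume "z \<in> space (M \<Otimes>\<^sub>M M)"
    then have "h (snd z, fst z) = - h (fst z, snd z)"
      by (intro anti) (auto simp: space_pair_measure)
    then show "h (prod.swap z) * m (fst z) = - (h z * m (fst z))"
      by (simp add: prod.swap_def)
  qed
  finally have e5: "(\<integral>z. h z * m (snd z) \<partial>(M \<Otimes>\<^sub>M M)) = - b"
    using e4 by simp
  have e6: "(\<integral>z. m (fst z) * m (snd z) \<partial>(M \<Otimes>\<^sub>M M)) = (\<integral>y. m y \<partial>M)\<^sup>2"
    using Q.integral_fst'[OF i6] by (simp add: power2_eq_square)
  \<comment> \<open>the interaction term of the Hoeffding decomposition of \<open>h\<close>, up to its mean\<close>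
  have "0 \<le> (\<integral>z. (h z - m (fst z) + m (snd z))\<^sup>2 \<partial>(M \<Otimes>\<^sub>M M))" by simp
  also have "\<dots> = (\<integral>z. h z * h z + m (fst z) * m (fst z) + m (snd z) * m (snd z)
      - 2 * (h z * m (fst z)) + 2 * (h z * m (snd z)) - 2 * (m (fst z) * m (snd z)) \<partial>(M \<Otimes>\<^sub>M M))"
    by (intro Bochner_Integration.integral_cong) (auto simp: power2_eq_square algebra_simps)
  also have "\<dots> = (\<integral>z. h z * h z \<partial>(M \<Otimes>\<^sub>M M)) - 2 * b - 2 * (\<integral>y. m y \<partial>M)\<^sup>2"
    using i1 i2 i3 i4 i5 i6 by (simp add: e2 e3 e4 e5 e6)
  finally have ge: "2 * b \<le> (\<integral>z. h z * h z \<partial>(M \<Otimes>\<^sub>M M))"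
    using zero_le_power2[of "\<integral>y. m y \<partial>M"] by linarith
  have "(\<integral>y. Var M (\<lambda>x. h (y, x)) \<partial>M) = (\<integral>y. (\<integral>x. h (y, x) * h (y, x) \<partial>M) - m y * m y \<partial>M)"
    by (simp add: Var_def m_def power2_eq_square)
  also have "\<dots> = (\<integral>z. h z * h z \<partial>(M \<Otimes>\<^sub>M M)) - b"
  proof (subst Bochner_Integration.integral_diff)
    show "integrable M (\<lambda>y. \<integral>x. h (y, x) * h (y, x) \<partial>M)" using Q.integrable_fst'[OF i1] by simp
    show "integrable M (\<lambda>y. m y * m y)"
      using prodB[OF mB mB] by (intro integrable_const_bound[of _ "B * B"] AE_I2) (simp_all only: real_norm_def, measurable)
    show "(\<integral>y. (\<integral>x. h (y, x) * h (y, x) \<partial>M) \<partial>M) - (\<integral>y. m y * m y \<partial>M)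
        = (\<integral>z. h z * h z \<partial>(M \<Otimes>\<^sub>M M)) - b"
      using Q.integral_fst'[OF i1] by (simp add: b_def)
  qed
  finally show ?thesis using ge by (simp add: power2_eq_square)
qed

text \<open>(T u)^2 = |u|^p turns a p-th moment into a second moment, accessible to the Poincare
  inequality, while T stays C^1 and odd. The last bound is Young's inequality with exponent p/2 for
  u^2 and (p W / sqrt 2)^2; the constant comes from 2 (p/2)^2 = (p / sqrt 2)^2.\<close>

lemma signed_power_exists:
  fixes p :: real
  assumes p: "2 \<le> p"
  obtains T T' :: "real \<Rightarrow> real" where
    "\<And>u. (T has_real_derivative T' u) (at u)" "continuous_on UNIV T'"
    "\<And>u. T (- u) = - T u" "\<And>u. (T u)\<^sup>2 = \<bar>u\<bar> powr p"
    "\<And>u W. 0 \<le> W \<Longrightarrow>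
      2 * (T' u * W)\<^sup>2 \<le> (1 - 2 / p) * \<bar>u\<bar> powr p + 2 / p * (p / sqrt 2 * W) powr p"
proof (cases "p = 2")
  \<comment> \<open>separate, since \<open>0 powr 0 = 0\<close> would make the formula for \<open>T'\<close> below vanish at \<open>0\<close>\<close>
  case True
  show ?thesis
    by (rule that[of "\<lambda>u. u" "\<lambda>u. 1"]) (use True in \<open>auto simp: powr_numeral power_mult_distrib power_divide\<close>)
next
  case False
  with p have p2: "2 < p" by simp
  define a where "a = p / 2"
  have a: "1 < a" using p2 by (simp add: a_def)
  define T where "T = (\<lambda>u::real. sgn u * \<bar>u\<bar> powr a)"
  define T' where "T' = (\<lambda>u::real. a * \<bar>u\<bar> powr (a - 1))"
  have d: "(T has_real_derivative T' u) (at u)" for u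
  proof -
    consider "u > 0" | "u < 0" | "u = 0" by linarith
    then show ?thesis
    proof cases
      case 1
      have "((\<lambda>u. u powr a) has_real_derivative T' u) (at u)"
        using 1 by (auto intro!: derivative_eq_intros simp: T'_def)
      moreover have "eventually (\<lambda>v. T v = v powr a) (nhds u)"
        using eventually_nhds_in_open[of "{0<..}" u] 1
        by (auto elim!: eventually_mono simp: T_def)
      ultimately show ?thesis by (subst DERIV_cong_ev[OF refl _ refl]) auto
    next
      case 2
      have "((\<lambda>u. - ((- u) powr a)) has_real_derivative T' u) (at u)"
        using 2 by (auto intro!: derivative_eq_intros simp: T'_def)
      moreover have "eventually (\<lambda>v. T v = - ((- v) powr a)) (nhds u)"
        using eventually_nhds_in_open[of "{..<0}" u] 2
        by (auto elim!: eventually_mono simp: T_def)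
      ultimately show ?thesis by (subst DERIV_cong_ev[OF refl _ refl]) auto
    next
      case 3
      \<comment> \<open>At 0 the difference quotient is |v|^(a - 1), which tends to 0 because a >
        1.\<close>
      have "((\<lambda>v::real. \<bar>v\<bar> powr (a - 1)) \<longlongrightarrow> \<bar>0\<bar> powr (a - 1)) (at 0)"
        using a by (intro tendsto_powr' tendsto_rabs tendsto_ident_at tendsto_const) auto
      moreover have "(T v - T 0) / (v - 0) = \<bar>v\<bar> powr (a - 1)" if "v \<noteq> 0" for v
        using that by (auto simp: T_def powr_diff sgn_if)
      ultimately have "((\<lambda>v. (T v - T 0) / (v - 0)) \<longlongrightarrow> 0) (at 0)"
        by (subst tendsto_cong[where g = "\<lambda>v. \<bar>v\<bar> powr (a - 1)"])
          (auto simp: eventually_at_filter)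
      then show ?thesis using 3 a by (simp add: has_field_derivative_iff T'_def)
    qed
  qed
  show ?thesis
  proof (rule that[of T T'])
    show "continuous_on UNIV T'"
      using a unfolding T'_def
      by (intro continuous_on_mult continuous_on_powr' continuous_intros) auto
    show "T (- u) = - T u" for u by (auto simp: T_def sgn_if)
    show "(T u)\<^sup>2 = \<bar>u\<bar> powr p" for u
      by (auto simp: T_def power_mult_distrib sgn_if a_def powr_powr simp flip: powr_numeral)
    show "2 * (T' u * W)\<^sup>2 \<le> (1 - 2 / p) * \<bar>u\<bar> powr p + 2 / p * (p / sqrt 2 * W) powr p"
      if W: "0 \<le> W" for u W
    proof -
      have u2: "(v\<^sup>2) powr b = \<bar>v\<bar> powr (2 * b)" for v b :: real
        using powr_powr[of "\<bar>v\<bar>" 2 b] by simp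
      have "(u\<^sup>2) powr (a - 1) * (p\<^sup>2 / 2 * W\<^sup>2)
          \<le> (p\<^sup>2 / 2 * W\<^sup>2) powr a / a + (1 - 1 / a) * (u\<^sup>2) powr a"
        using a by (intro powr_Young) auto
      also have "(u\<^sup>2) powr a = \<bar>u\<bar> powr p"
        using u2[of u a] by (simp add: a_def)
      also have "p\<^sup>2 / 2 * W\<^sup>2 = (p / sqrt 2 * W)\<^sup>2"
        by (simp add: power_mult_distrib power_divide)
      also have "(p / sqrt 2 * W)\<^sup>2 powr a = (p / sqrt 2 * W) powr p"
        unfolding u2 using W p by (simp add: a_def)
      finally have "(u\<^sup>2) powr (a - 1) * (p / sqrt 2 * W)\<^sup>2
          \<le> (p / sqrt 2 * W) powr p / a + (1 - 1 / a) * \<bar>u\<bar> powr p" .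
      moreover have "(u\<^sup>2) powr (a - 1) = (\<bar>u\<bar> powr (a - 1))\<^sup>2"
        unfolding u2 by (simp add: powr_add[symmetric] power2_eq_square[of "_ powr _"])
      moreover have "2 * (T' u * W)\<^sup>2 = (\<bar>u\<bar> powr (a - 1))\<^sup>2 * (p / sqrt 2 * W)\<^sup>2"
        by (simp add: T'_def a_def power_mult_distrib power_divide)
      ultimately show ?thesis by (simp add: a_def ac_simps)
    qed
  qed (rule d)
qed

section \<open>Calculus of C^1 functions along the coordinate axes\<close>

lemma Cd_on_1_iff:
  "Cd_on 1 G g \<longleftrightarrow> continuous_on G g \<and> (\<forall>i. continuous_on G (partial_deriv i g)) \<and>
     (\<forall>i. \<forall>x\<in>G. ((\<lambda>t. g (x + t *\<^sub>R axis i 1)) has_real_derivative partial_deriv i g x) (at 0))"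
    (is "?L = ?R")
proof
  assume ?L
  then have c: "continuous_on G (iter_partial is g)" if "length is \<le> 1" for "is"
    using that by (auto simp: Cd_on_def)
  have "continuous_on G (partial_deriv i g)" for i using c[of "[i]"] by simp
  moreover have "(\<lambda>t. g (x + t *\<^sub>R axis i 1)) field_differentiable (at 0)" if "x \<in> G" for i x
    using \<open>?L\<close> that unfolding Cd_on_def by (metis iter_partial.simps(1) length_0_conv zero_less_one)
  ultimately show ?R using c[of "[]"]
    by (simp add: partial_deriv_def field_differentiable_derivI)
next
  assume R: ?R
  have "continuous_on G (iter_partial is g)" if "length is \<le> 1" for "is"
    using R that by (cases "is") auto
  moreover have "(\<lambda>t. g (x + t *\<^sub>R axis i 1)) field_differentiable (at 0)" if "x \<in> G" for i x
    using R that unfolding field_differentiable_def by blast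
  ultimately show ?L
    by (auto simp: Cd_on_def)
qed

text \<open>Candidate partial derivatives are verified one axis at a time, so one-variable rules are
  enough for compositions, derivative forms and soft maxima.\<close>

lemma
  assumes cont: "continuous_on G g" "\<And>i. continuous_on G (D i)"
    and der: "\<And>i x. x \<in> G \<Longrightarrow> ((\<lambda>t. g (x + t *\<^sub>R axis i 1)) has_real_derivative D i x) (at 0)"
  shows Cd_on_1I: "Cd_on 1 G g" and gradient_eqI: "x \<in> G \<Longrightarrow> gradient g x = (\<chi> i. D i x)"
proof -
  have eq: "partial_deriv i g x = D i x" if "x \<in> G" for i x
    using der[OF that, of i] by (simp add: partial_deriv_def DERIV_imp_deriv)
  then have "continuous_on G (partial_deriv i g)" for i
    using cont(2)[of i] by (subst continuous_on_cong[OF refl eq]) auto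
  with cont der eq show "Cd_on 1 G g" unfolding Cd_on_1_iff by simp
  show "x \<in> G \<Longrightarrow> gradient g x = (\<chi> i. D i x)" by (simp add: gradient_def eq)
qed

lemma
  assumes g: "Cd_on 1 G g"
    and \<phi>: "\<And>u. (\<phi> has_real_derivative \<phi>' u) (at u)" "continuous_on UNIV \<phi>'"
  shows Cd_on_1_compose: "Cd_on 1 G (\<lambda>x. \<phi> (g x))"
    and gradient_compose: "x \<in> G \<Longrightarrow> gradient (\<lambda>x. \<phi> (g x)) x = \<phi>' (g x) *\<^sub>R gradient g x"
proof -
  have "continuous_on UNIV \<phi>"
    using \<phi>(1) DERIV_isCont continuous_at_imp_continuous_on by blast
  then have c: "continuous_on G (\<lambda>x. \<phi> (g x))" "continuous_on G (\<lambda>x. \<phi>' (g x) * partial_deriv i g x)" for i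
    using g \<phi>(2) unfolding Cd_on_1_iff
    by (auto intro!: continuous_on_compose2[of UNIV \<phi>] continuous_on_compose2[of UNIV \<phi>'] continuous_on_mult)
  have d: "((\<lambda>t. \<phi> (g (x + t *\<^sub>R axis i 1))) has_real_derivative \<phi>' (g x) * partial_deriv i g x) (at 0)"
    if "x \<in> G" for x i
  proof (rule DERIV_chain2[where f = \<phi>])
    show "(\<phi> has_real_derivative \<phi>' (g x)) (at (g (x + 0 *\<^sub>R axis i 1)))" using \<phi>(1)[of "g x"] by simp
    show "((\<lambda>t. g (x + t *\<^sub>R axis i 1)) has_real_derivative partial_deriv i g x) (at 0)"
      using g that unfolding Cd_on_1_iff by blast
  qed
  show "Cd_on 1 G (\<lambda>x. \<phi> (g x))" by (rule Cd_on_1I[OF c d])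
  show "x \<in> G \<Longrightarrow> gradient (\<lambda>x. \<phi> (g x)) x = \<phi>' (g x) *\<^sub>R gradient g x"
    by (subst gradient_eqI[OF c d]) (auto simp: vec_eq_iff gradient_def)
qed

section \<open>Consequences of the Poincare inequality for C^1 functions\<close>

locale weighted_poincare_space = prob_space \<mu>
  for G :: "(real ^ 'n::finite) set" and \<mu> :: "(real ^ 'n) measure" and w :: "real ^ 'n \<Rightarrow> real" +
  assumes sets_\<mu>: "sets \<mu> = sets (restrict_space borel G)"
    and w_measurable [measurable]: "w \<in> borel_measurable \<mu>"
    and w_nonneg: "\<And>x. x \<in> G \<Longrightarrow> 0 \<le> w x"
    and poincare: "weighted_poincare G \<mu> w"
begin

lemma space_\<mu>: "space \<mu> = G"
  using sets_eq_imp_space_eq[OF sets_\<mu>] by (simp add: space_restrict_space)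

lemma continuous_on_measurable: "continuous_on G g \<Longrightarrow> g \<in> borel_measurable \<mu>"
  using borel_measurable_continuous_on_restrict measurable_cong_sets[OF sets_\<mu> refl] by blast

lemma Var_le:
  "Cd_on 1 G g \<Longrightarrow> bounded (g ` G) \<Longrightarrow>
    ennreal (Var \<mu> g) \<le> (\<integral>\<^sup>+x. ennreal ((norm (gradient g x) * w x)\<^sup>2) \<partial>\<mu>)"
  using poincare by (simp add: weighted_poincare_def power_mult_distrib)

text \<open>With X = E |g x - g y|^p, the averaged Poincare inequality and Young give X <= (1 - 2/p)
  X + (2/p) (p / sqrt 2)^p E |W|^p. Boundedness of g makes X finite, so X can be solved for. The
  majorant W is kept apart from the gradient so that truncations and smooth approximations can share
  one right-hand side.\<close>

lemma Lq_norm_diff_le_bounded: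
  assumes g: "Cd_on 1 G g" "bounded (g ` G)" and p: "2 \<le> p"
    and W [measurable]: "W \<in> borel_measurable \<mu>"
    and le: "\<And>x. x \<in> G \<Longrightarrow> norm (gradient g x) * w x \<le> W x"
  shows "Lq_norm (\<mu> \<Otimes>\<^sub>M \<mu>) p (\<lambda>(x, y). g x - g y) \<le> ennreal (p / sqrt 2) * Lq_norm \<mu> p W"
proof (cases "Lq_norm \<mu> p W")
  case (real c)
  obtain T T' where T: "\<And>u. (T has_real_derivative T' u) (at u)" "continuous_on UNIV T'"
    and odd: "\<And>u. T (- u) = - T u" and sq: "\<And>u. (T u)\<^sup>2 = \<bar>u\<bar> powr p"
    and Young: "\<And>u W. 0 \<le> W \<Longrightarrow>
      2 * (T' u * W)\<^sup>2 \<le> (1 - 2 / p) * \<bar>u\<bar> powr p + 2 / p * (p / sqrt 2 * W) powr p"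
    using signed_power_exists[OF p] by metis
  obtain K where K: "\<And>x. x \<in> G \<Longrightarrow> \<bar>g x\<bar> \<le> K" using g(2) by (auto simp: bounded_iff)
  have [measurable]: "g \<in> borel_measurable \<mu>"
    using g by (intro continuous_on_measurable) (simp only: Cd_on_1_iff)
  have "continuous_on UNIV T"
    using T(1) DERIV_isCont continuous_at_imp_continuous_on by blast
  then have [measurable]: "T \<in> borel_measurable borel" by (rule borel_measurable_continuous_onI)
  have Wpos: "0 \<le> W x" if "x \<in> G" for x
    using le[OF that] w_nonneg[OF that] mult_nonneg_nonneg[OF norm_ge_zero] order.trans by blast
  define h where "h = (\<lambda>(y, x). T (g x - g y))"
  have h [measurable]: "h \<in> borel_measurable (\<mu> \<Otimes>\<^sub>M \<mu>)" unfolding h_def by measurable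
  have hsq: "(h (y, x))\<^sup>2 = \<bar>g x - g y\<bar> powr p" for x y by (simp add: h_def sq)
  define B where "B = sqrt ((2 * K) powr p)"
  have B0: "0 \<le> B" by (simp add: B_def)
  have hB: "\<bar>h (y, x)\<bar> \<le> B" if "x \<in> G" "y \<in> G" for x y
  proof -
    have "\<bar>g x - g y\<bar> powr p \<le> (2 * K) powr p"
      using K[OF that(1)] K[OF that(2)] p by (intro powr_mono2) auto
    then show ?thesis unfolding B_def by (metis hsq real_sqrt_abs real_sqrt_le_mono)
  qed
  interpret Q: pair_prob_space \<mu> \<mu> ..
  have ih: "integrable (\<mu> \<Otimes>\<^sub>M \<mu>) (\<lambda>z. (h z)\<^sup>2)"
  proof (rule Q.P.integrable_const_bound[of _ "B\<^sup>2"])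
    show "AE z in \<mu> \<Otimes>\<^sub>M \<mu>. norm ((h z)\<^sup>2) \<le> B\<^sup>2"
      using hB B0 by (intro AE_I2) (auto simp: space_pair_measure space_\<mu> intro!: power2_le_iff_abs_le[THEN iffD2])
  qed measurable
  define X where "X = (\<integral>z. (h z)\<^sup>2 \<partial>(\<mu> \<Otimes>\<^sub>M \<mu>))"
  have X0: "0 \<le> X" by (simp add: X_def)
  have Xenn: "ennreal X = (\<integral>\<^sup>+y. \<integral>\<^sup>+x. ennreal (\<bar>g x - g y\<bar> powr p) \<partial>\<mu> \<partial>\<mu>)"
    using nn_integral_eq_integral[OF ih] nn_integral_fst[of "\<lambda>z. ennreal ((h z)\<^sup>2)" \<mu>]
    by (simp add: X_def hsq)
  have Var0: "0 \<le> Var \<mu> (\<lambda>x. h (y, x))" if "y \<in> G" for y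
  proof -
    have [measurable]: "(\<lambda>x. h (y, x)) \<in> borel_measurable \<mu>" by (simp add: h_def)
    have "integrable \<mu> (\<lambda>x. h (y, x))"
      using hB B0 that by (intro integrable_const_bound[of _ B] AE_I2) (auto simp: space_\<mu>)
    moreover have "integrable \<mu> (\<lambda>x. (h (y, x))\<^sup>2)"
      using hB B0 that by (intro integrable_const_bound[of _ "B\<^sup>2"] AE_I2)
        (auto simp: space_\<mu> intro!: power2_le_iff_abs_le[THEN iffD2])
    ultimately show ?thesis
      using variance_eq[of "\<lambda>x. h (y, x)"] variance_positive[of "\<lambda>x. h (y, x)"]
      by (simp add: Var_def)
  qed
  have section_le: "2 * ennreal (Var \<mu> (\<lambda>x. h (y, x)))
      \<le> (\<integral>\<^sup>+x. ennreal (1 - 2 / p) * ennreal (\<bar>g x - g y\<bar> powr p)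
            + ennreal (2 / p * (p / sqrt 2) powr p) * ennreal (\<bar>W x\<bar> powr p) \<partial>\<mu>)"
    if y: "y \<in> G" for y
  proof -
    have der: "((\<lambda>u. T (u - g y)) has_real_derivative T' (u - g y)) (at u)" for u
      using T(1)[of "u - g y"] DERIV_shift[of T "T' (u - g y)" u "- g y"] by simp
    have cont: "continuous_on UNIV (\<lambda>u. T' (u - g y))"
      by (intro continuous_on_compose2[OF T(2)] continuous_intros) auto
    have "Cd_on 1 G (\<lambda>x. h (y, x))"
      using Cd_on_1_compose[OF g(1) der cont] by (simp add: h_def)
    moreover have "bounded ((\<lambda>x. h (y, x)) ` G)"
      using hB y by (auto simp: bounded_iff)
    ultimately have "ennreal (Var \<mu> (\<lambda>x. h (y, x)))
        \<le> (\<integral>\<^sup>+x. ennreal ((norm (gradient (\<lambda>x. h (y, x)) x) * w x)\<^sup>2) \<partial>\<mu>)"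
      by (rule Var_le)
    then have "2 * ennreal (Var \<mu> (\<lambda>x. h (y, x)))
        \<le> 2 * (\<integral>\<^sup>+x. ennreal ((T' (g x - g y) * W x)\<^sup>2) \<partial>\<mu>)"
    proof (rule order.trans[OF mult_left_mono mult_left_mono[OF nn_integral_mono]])
      fix x assume "x \<in> space \<mu>"
      then have x: "x \<in> G" by (simp add: space_\<mu>)
      have "gradient (\<lambda>x. h (y, x)) x = T' (g x - g y) *\<^sub>R gradient g x"
        using gradient_compose[OF g(1) der cont x] by (simp add: h_def)
      then have "norm (gradient (\<lambda>x. h (y, x)) x) * w x = \<bar>T' (g x - g y)\<bar> * (norm (gradient g x) * w x)"
        by simp
      also have "\<dots> \<le> \<bar>T' (g x - g y)\<bar> * W x" using le[OF x] by (intro mult_left_mono) auto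
      finally have "(norm (gradient (\<lambda>x. h (y, x)) x) * w x)\<^sup>2 \<le> (\<bar>T' (g x - g y)\<bar> * W x)\<^sup>2"
        using w_nonneg[OF x] by (intro power_mono) auto
      then show "ennreal ((norm (gradient (\<lambda>x. h (y, x)) x) * w x)\<^sup>2) \<le> ennreal ((T' (g x - g y) * W x)\<^sup>2)"
        by (intro ennreal_leI) (simp add: power_mult_distrib)
    qed auto
    also have "\<dots> = (\<integral>\<^sup>+x. ennreal (2 * (T' (g x - g y) * W x)\<^sup>2) \<partial>\<mu>)"
    proof -
      have [measurable]: "T' \<in> borel_measurable borel"
        using T(2) by (rule borel_measurable_continuous_onI)
      show ?thesis by (subst nn_integral_cmult[symmetric]) (auto simp: ennreal_mult)
    qed
    also have "\<dots> \<le> (\<integral>\<^sup>+x. ennreal (1 - 2 / p) * ennreal (\<bar>g x - g y\<bar> powr p)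
            + ennreal (2 / p * (p / sqrt 2) powr p) * ennreal (\<bar>W x\<bar> powr p) \<partial>\<mu>)"
    proof (rule nn_integral_mono)
      fix x assume "x \<in> space \<mu>"
      then have x: "x \<in> G" by (simp add: space_\<mu>)
      have "2 * (T' (g x - g y) * W x)\<^sup>2
          \<le> (1 - 2 / p) * \<bar>g x - g y\<bar> powr p + 2 / p * (p / sqrt 2 * W x) powr p"
        using Wpos[OF x] by (rule Young)
      also have "2 / p * (p / sqrt 2 * W x) powr p = 2 / p * (p / sqrt 2) powr p * \<bar>W x\<bar> powr p"
        using Wpos[OF x] by (subst powr_mult) simp
      finally show "ennreal (2 * (T' (g x - g y) * W x)\<^sup>2) \<le> ennreal (1 - 2 / p) * ennreal (\<bar>g x - g y\<bar> powr p)
            + ennreal (2 / p * (p / sqrt 2) powr p) * ennreal (\<bar>W x\<bar> powr p)"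
        using p by (simp add: ennreal_leI flip: ennreal_mult ennreal_plus)
    qed
    finally show ?thesis .
  qed
  have "ennreal X \<le> ennreal (2 * (\<integral>y. Var \<mu> (\<lambda>x. h (y, x)) \<partial>\<mu>))"
    unfolding X_def
  proof (intro ennreal_leI antisymmetric_variance[where B = B])
    show "h (x, y) = - h (y, x)" for x y using odd[of "g x - g y"] by (simp add: h_def)
  qed (use hB in \<open>auto simp: space_\<mu>\<close>)
  also have "\<dots> = 2 * ennreal (\<integral>y. Var \<mu> (\<lambda>x. h (y, x)) \<partial>\<mu>)" by (simp add: ennreal_mult')
  \<comment> \<open>If the variance of the sections were not integrable, its Bochner integral would
    be 0 by convention and the bound trivial.\<close>
  also have "ennreal (\<integral>y. Var \<mu> (\<lambda>x. h (y, x)) \<partial>\<mu>) \<le> (\<integral>\<^sup>+y. ennreal (Var \<mu> (\<lambda>x. h (y, x))) \<partial>\<mu>)"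
  proof (cases "integrable \<mu> (\<lambda>y. Var \<mu> (\<lambda>x. h (y, x)))")
    case True
    then show ?thesis using Var0 by (subst nn_integral_eq_integral) (auto simp: space_\<mu>)
  qed (simp add: not_integrable_integral_eq)
  also have "2 * (\<integral>\<^sup>+y. ennreal (Var \<mu> (\<lambda>x. h (y, x))) \<partial>\<mu>)
      = (\<integral>\<^sup>+y. 2 * ennreal (Var \<mu> (\<lambda>x. h (y, x))) \<partial>\<mu>)"
    unfolding Var_def by (rule nn_integral_cmult[symmetric]) measurable
  also have "\<dots> \<le> (\<integral>\<^sup>+y. \<integral>\<^sup>+x. ennreal (1 - 2 / p) * ennreal (\<bar>g x - g y\<bar> powr p)
            + ennreal (2 / p * (p / sqrt 2) powr p) * ennreal (\<bar>W x\<bar> powr p) \<partial>\<mu> \<partial>\<mu>)"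
    by (intro nn_integral_mono section_le) (simp add: space_\<mu>)
  also have "\<dots> = ennreal (1 - 2 / p) * ennreal X
      + ennreal (2 / p * (p / sqrt 2) powr p) * (\<integral>\<^sup>+x. ennreal (\<bar>W x\<bar> powr p) \<partial>\<mu>)"
    by (simp add: nn_integral_add nn_integral_cmult Xenn emeasure_space_1)
  also have "(\<integral>\<^sup>+x. ennreal (\<bar>W x\<bar> powr p) \<partial>\<mu>) \<le> ennreal (c powr p)"
    using Lq_norm_le_iff[of p c \<mu> W] real p by simp
  finally have "ennreal X \<le> ennreal (1 - 2 / p) * ennreal X
      + ennreal (2 / p * (p / sqrt 2) powr p) * ennreal (c powr p)"
    by (simp add: add_left_mono mult_left_mono)
  also have "\<dots> = ennreal ((1 - 2 / p) * X + 2 / p * (p / sqrt 2) powr p * c powr p)"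
    using p X0 by (simp flip: ennreal_mult ennreal_plus)
  finally have "X \<le> (1 - 2 / p) * X + 2 / p * (p / sqrt 2) powr p * c powr p"
    using p X0 by (subst (asm) ennreal_le_iff) auto
  \<comment> \<open>X is a real number, so (1 - 2/p) X moves to the left and the common factor 2/p
    cancels.\<close>
  then have "X \<le> (p / sqrt 2) powr p * c powr p"
    using p by (simp add: field_simps)
  then have "ennreal X \<le> ennreal ((p / sqrt 2 * c) powr p)"
    by (subst powr_mult) (rule ennreal_leI)
  moreover have "ennreal X = (\<integral>\<^sup>+z. ennreal (\<bar>(\<lambda>(x, y). g x - g y) z\<bar> powr p) \<partial>(\<mu> \<Otimes>\<^sub>M \<mu>))"
    unfolding Xenn by (subst nn_integral_fst[symmetric]) (auto simp: abs_minus_commute)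
  ultimately have "Lq_norm (\<mu> \<Otimes>\<^sub>M \<mu>) p (\<lambda>(x, y). g x - g y) \<le> ennreal (p / sqrt 2 * c)"
    using p real by (subst Lq_norm_le_iff) auto
  also have "ennreal (p / sqrt 2 * c) = ennreal (p / sqrt 2) * Lq_norm \<mu> p W"
    using real p by (subst ennreal_mult) auto
  finally show ?thesis .
next
  case top
  \<comment> \<open>The factor has to be nonzero, since \<open>0 * top = 0\<close> in
    \<open>ennreal\<close>.\<close>
  have "ennreal (p / sqrt 2) \<noteq> 0" using p by simp
  then have "ennreal (p / sqrt 2) * Lq_norm \<mu> p W = top" using top by (simp add: ennreal_mult_top)
  then show ?thesis by simp
qed

text \<open>The truncations arctan(c u)/c are C^1 and bounded with derivative in (0, 1], so they
  keep the majorant W. As c tends to 0 they converge to u, and Fatou's lemma passes to the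
  limit.\<close>

lemma Lq_norm_diff_le:
  assumes g: "Cd_on 1 G g" and p: "2 \<le> p"
    and W [measurable]: "W \<in> borel_measurable \<mu>"
    and le: "\<And>x. x \<in> G \<Longrightarrow> norm (gradient g x) * w x \<le> W x"
  shows "Lq_norm (\<mu> \<Otimes>\<^sub>M \<mu>) p (\<lambda>(x, y). g x - g y) \<le> ennreal (p / sqrt 2) * Lq_norm \<mu> p W"
proof -
  have [measurable]: "g \<in> borel_measurable \<mu>"
    using g by (intro continuous_on_measurable) (simp only: Cd_on_1_iff)
  define c where "c = (\<lambda>n::nat. 1 / real (Suc n))"
  have c: "0 < c n" for n by (simp add: c_def)
  have "c \<longlonglongrightarrow> 0" unfolding c_def by (rule LIMSEQ_inverse_real_of_nat[unfolded inverse_eq_divide])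
  then have c_lim: "filterlim c (at 0) sequentially"
    using c by (simp add: filterlim_at less_imp_neq[symmetric] order_less_imp_not_eq2)
  define \<phi> where "\<phi> = (\<lambda>n u. arctan (c n * u) / c n)"
  have \<phi>_lim: "(\<lambda>n. \<phi> n u) \<longlonglongrightarrow> u" for u
  proof -
    \<comment> \<open>The limit of the truncations is the derivative of arctan(h u) in h at
      0.\<close>
    have "((\<lambda>h. arctan (h * u)) has_real_derivative u) (at 0)"
      by (auto intro!: derivative_eq_intros)
    then have "((\<lambda>h. arctan (h * u) / h) \<longlongrightarrow> u) (at 0)"
      by (simp add: DERIV_def)
    from filterlim_compose[OF this c_lim] show ?thesis by (simp add: \<phi>_def)
  qed
  have der: "(\<phi> n has_real_derivative 1 / (1 + (c n * u)\<^sup>2)) (at u)" for n u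
    unfolding \<phi>_def using c[of n] by (auto intro!: derivative_eq_intros simp: inverse_eq_divide)
  have "1 + (c n * u)\<^sup>2 \<noteq> 0" for n u by (smt (verit) zero_le_power2)
  then have cont: "continuous_on UNIV (\<lambda>u. 1 / (1 + (c n * u)\<^sup>2))" for n
    by (intro continuous_intros) auto
  show ?thesis
  proof (rule Lq_norm_Fatou[where u = "\<lambda>n (x, y). \<phi> n (g x) - \<phi> n (g y)"])
    show "(\<lambda>(x, y). \<phi> n (g x) - \<phi> n (g y)) \<in> borel_measurable (\<mu> \<Otimes>\<^sub>M \<mu>)" for n
      unfolding \<phi>_def by measurable
    show "(\<lambda>n. (\<lambda>(x, y). \<phi> n (g x) - \<phi> n (g y)) z) \<longlonglongrightarrow> (\<lambda>(x, y). g x - g y) z" for z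
      by (cases z) (auto intro!: tendsto_diff \<phi>_lim)
    show "Lq_norm (\<mu> \<Otimes>\<^sub>M \<mu>) p (\<lambda>(x, y). \<phi> n (g x) - \<phi> n (g y)) \<le> ennreal (p / sqrt 2) * Lq_norm \<mu> p W" for n
    proof (rule Lq_norm_diff_le_bounded)
      show "Cd_on 1 G (\<lambda>x. \<phi> n (g x))" by (rule Cd_on_1_compose[OF g der cont])
      have "\<bar>\<phi> n u\<bar> \<le> pi / 2 / c n" for u
        using arctan_lbound[of "c n * u"] arctan_ubound[of "c n * u"] c[of n]
        by (auto simp: \<phi>_def divide_simps abs_le_iff)
      then show "bounded ((\<lambda>x. \<phi> n (g x)) ` G)" by (auto simp: bounded_iff)
      show "norm (gradient (\<lambda>x. \<phi> n (g x)) x) * w x \<le> W x" if x: "x \<in> G" for x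
      proof -
        have "norm (gradient (\<lambda>x. \<phi> n (g x)) x) = 1 / (1 + (c n * g x)\<^sup>2) * norm (gradient g x)"
          by (subst gradient_compose[OF g der cont x]) simp
        also have "\<dots> \<le> 1 * norm (gradient g x)"
          by (intro mult_right_mono) (auto simp: divide_simps)
        finally have "norm (gradient (\<lambda>x. \<phi> n (g x)) x) * w x \<le> norm (gradient g x) * w x"
          using w_nonneg[OF x] by (intro mult_right_mono) auto
        with le[OF x] show ?thesis by linarith
      qed
    qed (use p in auto)
  qed (use p in auto)
qed

lemma Lq_norm_centered_le_gradient:
  assumes g: "Cd_on 1 G g" and p: "2 \<le> p" and int: "integrable \<mu> g"
    and W: "W \<in> borel_measurable \<mu>" "\<And>x. x \<in> G \<Longrightarrow> norm (gradient g x) * w x \<le> W x"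
  shows "Lq_norm \<mu> p (\<lambda>x. g x - (\<integral>y. g y \<partial>\<mu>)) \<le> ennreal (p / sqrt 2) * Lq_norm \<mu> p W"
proof (rule order.trans[OF Lq_norm_centered_le[OF int]])
  show "Lq_norm (\<mu> \<Otimes>\<^sub>M \<mu>) p (\<lambda>(x, y). g x - g y) \<le> ennreal (p / sqrt 2) * Lq_norm \<mu> p W"
    by (rule Lq_norm_diff_le[OF g p W])
qed (use p in simp)

text \<open>Split g into its mean m and g - m: Jensen gives |m| <= ||g||_2, and the centred part is
  controlled by the gradient. If ||g||_2 is infinite the bound is trivial; otherwise g is integrable
  and the mean is meaningful.\<close>

lemma Lq_norm_le_L2_plus_gradient:
  assumes g: "Cd_on 1 G g" and p: "2 \<le> p"
    and W: "W \<in> borel_measurable \<mu>" "\<And>x. x \<in> G \<Longrightarrow> norm (gradient g x) * w x \<le> W x"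
  shows "Lq_norm \<mu> p g \<le> Lq_norm \<mu> 2 g + ennreal (p / sqrt 2) * Lq_norm \<mu> p W"
proof (cases "Lq_norm \<mu> 2 g")
  case (real c)
  have [measurable]: "g \<in> borel_measurable \<mu>"
    using g by (intro continuous_on_measurable) (simp only: Cd_on_1_iff)
  have sq: "(\<integral>\<^sup>+x. ennreal (\<bar>g x\<bar> powr 2) \<partial>\<mu>) \<le> ennreal (c powr 2)"
    using Lq_norm_le_iff[of 2 c \<mu> g] real by simp
  then have "(\<integral>\<^sup>+x. ennreal ((g x)\<^sup>2) \<partial>\<mu>) < \<infinity>"
    by (auto simp: top_unique less_top[symmetric])
  then have "integrable \<mu> (\<lambda>x. (g x)\<^sup>2)"
    by (intro integrableI_nonneg) auto
  then have int: "integrable \<mu> g"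
    by (rule square_integrable_imp_integrable[rotated]) measurable
  define m where "m = (\<integral>x. g x \<partial>\<mu>)"
  have "ennreal (\<bar>m\<bar> powr 2) \<le> ennreal (c powr 2)"
    unfolding m_def by (rule order.trans[OF powr_abs_expectation_le[OF int] sq]) simp
  then have "\<bar>m\<bar> ^ 2 \<le> c ^ 2"
    using real by simp
  then have "\<bar>m\<bar> \<le> c"
    using real by (rule_tac power2_le_imp_le)
  then have "Lq_norm \<mu> p (\<lambda>x. m) \<le> Lq_norm \<mu> 2 g"
    using p real by (simp add: Lq_norm_const ennreal_leI)
  moreover have "Lq_norm \<mu> p (\<lambda>x. g x - m) \<le> ennreal (p / sqrt 2) * Lq_norm \<mu> p W"
    unfolding m_def by (rule Lq_norm_centered_le_gradient[OF g p int W])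
  moreover have "Lq_norm \<mu> p (\<lambda>x. m + (g x - m)) \<le> Lq_norm \<mu> p (\<lambda>x. m) + Lq_norm \<mu> p (\<lambda>x. g x - m)"
    using p by (intro Lq_norm_triangle) auto
  ultimately have "Lq_norm \<mu> p (\<lambda>x. m + (g x - m))
      \<le> Lq_norm \<mu> 2 g + ennreal (p / sqrt 2) * Lq_norm \<mu> p W"
    by (rule_tac order.trans[OF _ add_mono])
  then show ?thesis by simp
qed simp

end

section \<open>Smooth approximation of the operator norms of the derivatives\<close>

lemma lists_of_length_Suc:
  "{is :: 'n list. length is = Suc k} = (\<lambda>(i, is). i # is) ` (UNIV \<times> {is. length is = k})"
  by (auto simp: length_Suc_conv image_iff)

lemma deriv_form_0 [simp]: "deriv_form 0 f x v = f x"
  by (simp add: deriv_form_def)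

text \<open>Splitting off the outermost derivative pairs \<open>v 0\<close> with what is formally
  the gradient of the k-th form in the remaining vectors. Both the sign change and the gradient
  bound below rest on this.\<close>

lemma deriv_form_Suc:
  fixes f :: "real ^ 'n::finite \<Rightarrow> real"
  shows "deriv_form (Suc k) f x v = (\<Sum>i\<in>UNIV. v 0 $ i *
    (\<Sum>is\<in>{is. length is = k}. iter_partial (i # is) f x * (\<Prod>j<k. v (Suc j) $ (is ! j))))"
proof -
  have inj: "inj_on (\<lambda>(i, is). i # is) (UNIV \<times> {is :: 'n list. length is = k})"
    by (auto simp: inj_on_def)
  have "deriv_form (Suc k) f x v = (\<Sum>(i, is)\<in>UNIV \<times> {is. length is = k}.
      iter_partial (i # is) f x * (\<Prod>j<Suc k. v j $ ((i # is) ! j)))"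
    unfolding deriv_form_def lists_of_length_Suc
    by (subst sum.reindex[OF inj]) (simp add: case_prod_unfold)
  also have "\<dots> = (\<Sum>i\<in>UNIV. \<Sum>is\<in>{is. length is = k}.
      iter_partial (i # is) f x * (\<Prod>j<Suc k. v j $ ((i # is) ! j)))"
    by (rule sum.cartesian_product[symmetric])
  finally show ?thesis
    by (simp add: prod.lessThan_Suc_shift sum_distrib_left ac_simps del: prod.lessThan_Suc)
qed

text \<open>A crude bound uniform in the unit vectors, which makes the supremum in
  \<open>deriv_op_norm\<close> one over a set bounded above.\<close>

lemma abs_deriv_form_le:
  assumes "\<And>j. j < k \<Longrightarrow> norm (v j) = 1"
  shows "\<bar>deriv_form k f x v\<bar> \<le> (\<Sum>is\<in>{is. length is = k}. \<bar>iter_partial is f x\<bar>)"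
proof -
  have "\<bar>iter_partial is f x * (\<Prod>j<k. v j $ (is ! j))\<bar> \<le> \<bar>iter_partial is f x\<bar>" for "is"
  proof -
    have "(\<Prod>j<k. \<bar>v j $ (is ! j)\<bar>) \<le> 1"
    proof (intro prod_le_1 conjI)
      show "\<bar>v j $ (is ! j)\<bar> \<le> 1" if "j \<in> {..<k}" for j
        using component_le_norm_cart[of "v j" "is ! j"] assms[of j] that by simp
    qed simp
    then show ?thesis
      by (simp add: abs_mult abs_prod mult_left_le)
  qed
  then show ?thesis
    unfolding deriv_form_def by (intro order.trans[OF sum_abs] sum_mono)
qed

lemma deriv_form_le_op_norm:
  assumes "\<And>j. j < k \<Longrightarrow> norm (v j) = 1"
  shows "deriv_form k f x v \<le> deriv_op_norm k f x"
  unfolding deriv_op_norm_def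
proof (rule cSUP_upper)
  show "bdd_above ((\<lambda>v. deriv_form k f x v) ` {v. \<forall>j<k. norm (v j) = 1})"
    using abs_deriv_form_le[of k _ f x]
    by (intro bdd_aboveI2[where M = "\<Sum>is\<in>{is. length is = k}. \<bar>iter_partial is f x\<bar>"])
      (simp add: abs_le_iff)
qed (use assms in auto)

text \<open>Negating the first vector negates the form, so the supremum without absolute values
  bounds both signs. In order 0 there is no vector to negate.\<close>

lemma abs_deriv_form_le_op_norm:
  assumes k: "1 \<le> k" and v: "\<And>j. j < k \<Longrightarrow> norm (v j) = 1"
  shows "\<bar>deriv_form k f x v\<bar> \<le> deriv_op_norm k f x"
proof -
  obtain l where l: "k = Suc l" using k by (cases k) auto
  have "deriv_form k f x (v(0 := - v 0)) = - deriv_form k f x v"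
    unfolding l deriv_form_Suc by (simp add: sum_negf)
  moreover have "deriv_form k f x (v(0 := - v 0)) \<le> deriv_op_norm k f x"
    using v k by (intro deriv_form_le_op_norm) auto
  ultimately show ?thesis
    using deriv_form_le_op_norm[of k v f x] v by (simp add: abs_le_iff)
qed

lemma deriv_op_norm_nonneg: "1 \<le> k \<Longrightarrow> 0 \<le> deriv_op_norm k f x"
  by (rule order.trans[OF abs_ge_zero abs_deriv_form_le_op_norm[of k "\<lambda>_. axis undefined 1"]]) simp_all

lemma iter_partial_DERIV:
  assumes "Cd_on d G f" "length is < d" "x \<in> G"
  shows "((\<lambda>t. iter_partial is f (x + t *\<^sub>R axis i 1)) has_real_derivative iter_partial (i # is) f x) (at 0)"
  using assms by (simp add: Cd_on_def partial_deriv_def field_differentiable_derivI)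

lemma continuous_on_deriv_form:
  assumes f: "Cd_on d G f" and k: "k \<le> d"
  shows "continuous_on G (\<lambda>x. deriv_form k f x v)"
  unfolding deriv_form_def using f k
  by (auto intro!: continuous_on_sum continuous_on_mult continuous_on_const simp: Cd_on_def)

lemma
  assumes f: "Cd_on d G f" and k: "k < d"
  shows Cd_on_1_deriv_form: "Cd_on 1 G (\<lambda>x. deriv_form k f x v)"
    and gradient_deriv_form: "x \<in> G \<Longrightarrow> gradient (\<lambda>x. deriv_form k f x v) x =
      (\<chi> i. \<Sum>is\<in>{is. length is = k}. iter_partial (i # is) f x * (\<Prod>j<k. v j $ (is ! j)))"
proof -
  have cont: "continuous_on G (iter_partial is f)" if "length is \<le> d" for "is"
    using f that by (simp add: Cd_on_def)
  have c: "continuous_on G (\<lambda>x. deriv_form k f x v)"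
    using f k by (intro continuous_on_deriv_form) auto
  have c': "continuous_on G (\<lambda>x. \<Sum>is\<in>{is. length is = k}. iter_partial (i # is) f x * (\<Prod>j<k. v j $ (is ! j)))" for i
    using k by (auto intro!: continuous_on_sum continuous_on_mult cont continuous_on_const simp del: iter_partial.simps)
  have d: "((\<lambda>t. deriv_form k f (x + t *\<^sub>R axis i 1) v) has_real_derivative
      (\<Sum>is\<in>{is. length is = k}. iter_partial (i # is) f x * (\<Prod>j<k. v j $ (is ! j)))) (at 0)"
    if "x \<in> G" for x i
    unfolding deriv_form_def using k that
    by (intro DERIV_sum DERIV_cmult_right iter_partial_DERIV[OF f]) auto
  show "Cd_on 1 G (\<lambda>x. deriv_form k f x v)" by (rule Cd_on_1I[OF c c' d])
  show "x \<in> G \<Longrightarrow> gradient (\<lambda>x. deriv_form k f x v) x =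
      (\<chi> i. \<Sum>is\<in>{is. length is = k}. iter_partial (i # is) f x * (\<Prod>j<k. v j $ (is ! j)))"
    by (rule gradient_eqI[OF c c' d])
qed

text \<open>The length of a nonzero gradient is its inner product with its own direction u;
  prepending u to the tuple turns this into a value of the form of order k + 1.\<close>

lemma norm_gradient_deriv_form_le:
  assumes f: "Cd_on d G f" and k: "k < d" and x: "x \<in> G"
    and v: "\<And>j. j < k \<Longrightarrow> norm (v j) = 1"
  shows "norm (gradient (\<lambda>x. deriv_form k f x v) x) \<le> deriv_op_norm (Suc k) f x"
proof (cases "gradient (\<lambda>x. deriv_form k f x v) x = 0")
  case True
  then show ?thesis by (simp add: deriv_op_norm_nonneg)
next
  case False
  define D where "D = gradient (\<lambda>x. deriv_form k f x v) x"
  define u where "u = D /\<^sub>R norm D"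
  have "D \<noteq> 0" using False by (simp add: D_def)
  have "norm D = u \<bullet> D"
    using \<open>D \<noteq> 0\<close> by (simp add: u_def dot_square_norm power2_eq_square)
  also have "\<dots> = deriv_form (Suc k) f x (case_nat u v)"
    unfolding deriv_form_Suc D_def gradient_deriv_form[OF f k x] by (simp add: inner_vec_def)
  also have "\<dots> \<le> deriv_op_norm (Suc k) f x"
    using v \<open>D \<noteq> 0\<close> by (intro deriv_form_le_op_norm) (auto simp: u_def split: nat.split)
  finally show ?thesis by (simp add: D_def)
qed

section \<open>Soft maxima of finitely many functions\<close>

text \<open>A soft maximum of |a 0|, ..., |a (N - 1)|: \<open>cosh\<close> is a smooth substitute
  for the exponential of the absolute value, and averaging instead of summing keeps the value below
  any common bound. \<open>N\<close> is both the number of terms and the sharpness, so one limit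
  suffices.\<close>

definition log_mean_cosh :: "nat \<Rightarrow> (nat \<Rightarrow> real) \<Rightarrow> real" where
  "log_mean_cosh N a = ln ((\<Sum>j<N. cosh (real N * a j)) / real N) / real N"

lemma cosh_le_exp_abs: "cosh t \<le> exp \<bar>t\<bar>" for t :: real
proof -
  have "exp t + exp (- t) \<le> exp \<bar>t\<bar> * 2"
    unfolding mult_2_right by (intro add_mono) auto
  then show ?thesis by (simp add: cosh_field_def)
qed

lemma exp_abs_le_cosh: "exp \<bar>t\<bar> / 2 \<le> cosh t" for t :: real
  by (cases "0 \<le> t") (auto simp: cosh_field_def)

lemma sum_cosh_ge: "real N \<le> (\<Sum>j<N. cosh (a j :: real))"
  using sum_mono[of "{..<N}" "\<lambda>_. 1" "\<lambda>j. cosh (a j)"] by (simp add: cosh_real_ge_1)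

lemma log_mean_cosh_nonneg: "0 \<le> log_mean_cosh N a"
proof (cases "N = 0")
  case False
  then show ?thesis
    using sum_cosh_ge[of N "\<lambda>j. real N * a j"] by (simp add: log_mean_cosh_def)
\<comment> \<open>For N = 0 the division by 0 yields 0.\<close>
qed (simp add: log_mean_cosh_def)

lemma log_mean_cosh_le:
  assumes a: "\<And>j. \<bar>a j\<bar> \<le> L" and N: "0 < N"
  shows "log_mean_cosh N a \<le> L"
proof -
  have "(\<Sum>j<N. cosh (real N * a j)) \<le> (\<Sum>j<N. exp (real N * L))"
  proof (rule sum_mono)
    fix j
    have "cosh (real N * a j) \<le> exp \<bar>real N * a j\<bar>" by (rule cosh_le_exp_abs)
    also have "\<dots> \<le> exp (real N * L)" using a[of j] by (simp add: abs_mult mult_left_mono)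
    finally show "cosh (real N * a j) \<le> exp (real N * L)" .
  qed
  then have "(\<Sum>j<N. cosh (real N * a j)) / real N \<le> exp (real N * L)"
    using N by (simp add: field_simps)
  moreover have "0 < (\<Sum>j<N. cosh (real N * a j)) / real N"
    using N sum_cosh_ge[of N "\<lambda>j. real N * a j"] by (intro divide_pos_pos) linarith+
  ultimately have "ln ((\<Sum>j<N. cosh (real N * a j)) / real N) \<le> real N * L"
    by (simp add: ln_le_cancel_iff[of _ "exp _", simplified])
  then show ?thesis using N by (simp add: log_mean_cosh_def field_simps)
qed

text \<open>A single term of the sum is kept. In the loss ln(2 N)/N the factor 2 comes from cosh t
  >= exp |t| / 2 and the factor N from averaging.\<close>

lemma log_mean_cosh_ge:
  assumes j: "j < N"
  shows "\<bar>a j\<bar> - ln (2 * real N) / real N \<le> log_mean_cosh N a"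
proof -
  have N: "0 < N" using j by simp
  have "exp (real N * \<bar>a j\<bar>) / 2 \<le> cosh (real N * a j)"
    using exp_abs_le_cosh[of "real N * a j"] by (simp add: abs_mult)
  also have "\<dots> \<le> (\<Sum>j<N. cosh (real N * a j))"
    using j by (intro member_le_sum) auto
  finally have "exp (real N * \<bar>a j\<bar>) / (2 * real N) \<le> (\<Sum>j<N. cosh (real N * a j)) / real N"
    using N by (simp add: field_simps)
  then have "ln (exp (real N * \<bar>a j\<bar>) / (2 * real N)) \<le> ln ((\<Sum>j<N. cosh (real N * a j)) / real N)"
    using N by (intro ln_mono) auto
  then have "real N * \<bar>a j\<bar> - ln (2 * real N) \<le> ln ((\<Sum>j<N. cosh (real N * a j)) / real N)"
    using N by (simp add: ln_div)
  then have "(real N * \<bar>a j\<bar> - ln (2 * real N)) / real N \<le> log_mean_cosh N a"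
    unfolding log_mean_cosh_def by (intro divide_right_mono) auto
  then show ?thesis using N by (simp add: diff_divide_distrib)
qed

text \<open>An index j with |a j| close to L is fixed; it enters the sum once n >= j, and the loss
  in the lower bound vanishes as n grows.\<close>

lemma log_mean_cosh_tendsto:
  assumes le: "\<And>j. \<bar>a j\<bar> \<le> L" and approx: "\<And>e. 0 < e \<Longrightarrow> \<exists>j. L - e < \<bar>a j\<bar>"
  shows "(\<lambda>n. log_mean_cosh (Suc n) a) \<longlonglongrightarrow> L"
proof (rule order_tendstoI)
  fix y assume y: "y < L"
  then obtain j where j: "L - (L - y) < \<bar>a j\<bar>" using approx[of "L - y"] by auto
  have "(\<lambda>n. ln (2 * real n) / real n) \<longlonglongrightarrow> 0"
    by real_asymp
  then have "(\<lambda>n. \<bar>a j\<bar> - ln (2 * real (Suc n)) / real (Suc n)) \<longlonglongrightarrow> \<bar>a j\<bar> - 0"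
    by (intro tendsto_diff tendsto_const) (rule LIMSEQ_Suc)
  then have "eventually (\<lambda>n. y < \<bar>a j\<bar> - ln (2 * real (Suc n)) / real (Suc n)) sequentially"
    by (rule order_tendstoD) (use j in simp)
  moreover have "eventually (\<lambda>n. j < Suc n) sequentially"
    using eventually_gt_at_top[of j] by (auto elim!: eventually_mono)
  ultimately show "eventually (\<lambda>n. y < log_mean_cosh (Suc n) a) sequentially"
    by eventually_elim (use log_mean_cosh_ge less_le_trans in blast)
next
  fix y assume "L < y"
  then have "log_mean_cosh (Suc n) a < y" for n
    using log_mean_cosh_le[of a L "Suc n", OF le] by simp
  then show "eventually (\<lambda>n. log_mean_cosh (Suc n) a < y) sequentially"
    by (simp add: always_eventually)
qed

text \<open>The inner factor N cancels the outer 1/N, and the gradient becomes the sum of the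
  gradients of the F j with coefficients sinh(N F_j) / sum cosh(N F_i). Since |sinh| <= cosh, their
  absolute values add up to at most 1.\<close>

lemma
  assumes F: "\<And>j. Cd_on 1 G (F j)" and N: "0 < N"
  shows Cd_on_1_log_mean_cosh: "Cd_on 1 G (\<lambda>x. log_mean_cosh N (\<lambda>j. F j x))"
    and norm_gradient_log_mean_cosh_le: "x \<in> G \<Longrightarrow> (\<And>j. norm (gradient (F j) x) \<le> L) \<Longrightarrow>
      norm (gradient (\<lambda>x. log_mean_cosh N (\<lambda>j. F j x)) x) \<le> L"
proof -
  define S where "S = (\<lambda>x. \<Sum>j<N. cosh (real N * F j x))"
  define D where "D = (\<lambda>i x. (\<Sum>j<N. sinh (real N * F j x) * partial_deriv i (F j) x) / S x)"
  have S: "0 < S x" for x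
    using sum_cosh_ge[of N "\<lambda>j. real N * F j x"] N by (simp add: S_def)
  have eq: "log_mean_cosh N (\<lambda>j. F j x) = ln (S x / real N) / real N" for x
    by (simp add: log_mean_cosh_def S_def)
  have cF: "continuous_on G (F j)" "continuous_on G (partial_deriv i (F j))"
    and dF: "x \<in> G \<Longrightarrow> ((\<lambda>t. F j (x + t *\<^sub>R axis i 1)) has_real_derivative partial_deriv i (F j) x) (at 0)"
    for i j x using F[of j] unfolding Cd_on_1_iff by blast+
  have cS: "continuous_on G S" unfolding S_def by (intro continuous_intros cF)
  have c: "continuous_on G (\<lambda>x. log_mean_cosh N (\<lambda>j. F j x))" "continuous_on G (D i)" for i
  proof -
    have "S x / real N \<noteq> 0" for x using S[of x] N by simp
    then show "continuous_on G (\<lambda>x. log_mean_cosh N (\<lambda>j. F j x))"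
      unfolding eq using N by (intro continuous_intros cS) auto
    show "continuous_on G (D i)"
      unfolding D_def using S by (intro continuous_intros cF cS) (simp add: order_less_imp_not_eq2)
  qed
  have d: "((\<lambda>t. log_mean_cosh N (\<lambda>j. F j (x + t *\<^sub>R axis i 1))) has_real_derivative D i x) (at 0)"
    if x: "x \<in> G" for x i
  proof -
    have "((\<lambda>t. S (x + t *\<^sub>R axis i 1)) has_real_derivative
        (\<Sum>j<N. sinh (real N * F j x) * (real N * partial_deriv i (F j) x))) (at 0)"
      unfolding S_def
    proof (rule DERIV_sum)
      fix j
      show "((\<lambda>t. cosh (real N * F j (x + t *\<^sub>R axis i 1))) has_real_derivative
        sinh (real N * F j x) * (real N * partial_deriv i (F j) x)) (at 0)"
        using dF[OF x, of j i] by (auto intro!: derivative_eq_intros)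
    qed
    then have "((\<lambda>t. ln (S (x + t *\<^sub>R axis i 1) / real N) / real N) has_real_derivative
        (1 / (S x / real N) * ((\<Sum>j<N. sinh (real N * F j x) * (real N * partial_deriv i (F j) x)) / real N)) / real N) (at 0)"
      using S[of x] N by (auto intro!: derivative_eq_intros)
    also have "(1 / (S x / real N) * ((\<Sum>j<N. sinh (real N * F j x) * (real N * partial_deriv i (F j) x)) / real N)) / real N = D i x"
      using N by (simp add: D_def sum_divide_distrib sum_distrib_left) 
    finally show ?thesis by (simp add: log_mean_cosh_def S_def)
  qed
  show "Cd_on 1 G (\<lambda>x. log_mean_cosh N (\<lambda>j. F j x))" by (rule Cd_on_1I[OF c d])
  assume x: "x \<in> G" and L: "\<And>j. norm (gradient (F j) x) \<le> L"
  have "gradient (\<lambda>x. log_mean_cosh N (\<lambda>j. F j x)) x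
      = (\<Sum>j<N. sinh (real N * F j x) *\<^sub>R gradient (F j) x) /\<^sub>R S x"
    by (subst gradient_eqI[OF c d x]) (simp_all add: vec_eq_iff D_def gradient_def divide_inverse mult.commute)
  also have "norm \<dots> \<le> (\<Sum>j<N. cosh (real N * F j x) * L) / S x"
  proof -
    have "norm (\<Sum>j<N. sinh (real N * F j x) *\<^sub>R gradient (F j) x)
        \<le> (\<Sum>j<N. \<bar>sinh (real N * F j x)\<bar> * norm (gradient (F j) x))"
      by (rule order.trans[OF norm_sum]) simp
    also have "\<dots> \<le> (\<Sum>j<N. cosh (real N * F j x) * L)"
    proof (intro sum_mono mult_mono L)
      fix j
      have "\<bar>sinh t\<bar> \<le> cosh t" for t :: real
        by (simp add: cosh_field_def sinh_field_def abs_le_iff field_simps)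
      then show "\<bar>sinh (real N * F j x)\<bar> \<le> cosh (real N * F j x)" .
    qed auto
    finally show ?thesis using S[of x] by (simp add: divide_simps)
  qed
  also have "\<dots> = L" using S[of x] by (simp add: S_def flip: sum_distrib_right)
  finally show "norm (gradient (\<lambda>x. log_mean_cosh N (\<lambda>j. F j x)) x) \<le> L" .
qed

section \<open>Operator norms as limits along a countable dense family\<close>

text \<open>One point of S is chosen from each basic open set that meets S.\<close>

lemma countable_dense_subset:
  fixes S :: "'a::second_countable_topology set"
  obtains T where "countable T" "T \<subseteq> S" "S \<subseteq> closure T"
proof -
  obtain B :: "'a set set" where B: "countable B" "topological_basis B"
    using ex_countable_basis by blast
  define T where "T = (\<lambda>U. SOME x. x \<in> U \<inter> S) ` {U \<in> B. U \<inter> S \<noteq> {}}"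
  have some: "(SOME x. x \<in> U \<inter> S) \<in> U \<inter> S" if "U \<inter> S \<noteq> {}" for U
    using that by (subst some_in_eq)
  show ?thesis
  proof
    show "countable T" using B(1) by (auto simp: T_def)
    show "T \<subseteq> S" using some by (auto simp: T_def)
    show "S \<subseteq> closure T"
    proof
      fix x assume "x \<in> S"
      have "\<exists>y\<in>T. y \<in> A" if "open A" "x \<in> A" for A
      proof -
        obtain U where U: "U \<in> B" "x \<in> U" "U \<subseteq> A"
          using topological_basisE[OF B(2) \<open>open A\<close> \<open>x \<in> A\<close>] by blast
        with \<open>x \<in> S\<close> some[of U] show ?thesis by (auto simp: T_def)
      qed
      then show "x \<in> closure T" unfolding closure_iff_nhds_not_empty by blast
    qed
  qed
qed

text \<open>Continuity refers to the product topology on sequences of vectors; only finitely many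
  coordinates enter.\<close>

lemma continuous_on_deriv_form_vectors: "continuous_on UNIV (deriv_form k f x)"
  unfolding deriv_form_def
  by (intro continuous_on_sum continuous_on_mult continuous_on_const continuous_on_prod
      continuous_on_component continuous_on_product_coordinates)

text \<open>The tuples do not depend on x, so each approximant is a soft maximum of finitely many
  fixed derivative forms and inherits their regularity in x.\<close>

lemma deriv_op_norm_dense_sequence:
  fixes f :: "real ^ 'n::finite \<Rightarrow> real"
  assumes k: "1 \<le> k"
  obtains e :: "nat \<Rightarrow> nat \<Rightarrow> real ^ 'n" where
    "\<And>m j. j < k \<Longrightarrow> norm (e m j) = 1"
    "\<And>x. (\<lambda>n. log_mean_cosh (Suc n) (\<lambda>m. deriv_form k f x (e m))) \<longlonglongrightarrow> deriv_op_norm k f x"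
proof -
  \<comment> \<open>Entries from index k on are unrestricted, as in \<open>deriv_op_norm\<close>.
    The sequences form a second countable product space, so V has a countable dense subset.\<close>
  define V where "V = {v :: nat \<Rightarrow> real ^ 'n. \<forall>j<k. norm (v j) = 1}"
  have "(\<lambda>_. axis undefined 1) \<in> V" by (simp add: V_def)
  obtain T where T: "countable T" "T \<subseteq> V" "V \<subseteq> closure T"
    using countable_dense_subset by blast
  with \<open>_ \<in> V\<close> have "T \<noteq> {}" by auto
  define e where "e = from_nat_into T"
  have ran: "range e = T" using T(1) \<open>T \<noteq> {}\<close> by (simp add: e_def range_from_nat_into)
  have eV: "norm (e m j) = 1" if "j < k" for m j
    using T(2) ran that by (auto simp: V_def)
  show ?thesis
  proof (rule that[OF eV])
    fix x
    show "(\<lambda>n. log_mean_cosh (Suc n) (\<lambda>m. deriv_form k f x (e m))) \<longlonglongrightarrow> deriv_op_norm k f x"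
    proof (rule log_mean_cosh_tendsto)
      show "\<bar>deriv_form k f x (e j)\<bar> \<le> deriv_op_norm k f x" for j
        using k eV by (rule abs_deriv_form_le_op_norm)
      fix \<epsilon> :: real assume "0 < \<epsilon>"
      have "\<exists>v\<in>V. deriv_op_norm k f x - \<epsilon> < deriv_form k f x v"
      proof (rule ccontr)
        assume "\<not> ?thesis"
        then have "(SUP v\<in>V. deriv_form k f x v) \<le> deriv_op_norm k f x - \<epsilon>"
          using \<open>_ \<in> V\<close> by (intro cSUP_least) (auto simp: not_less)
        with \<open>0 < \<epsilon>\<close> show False by (simp add: deriv_op_norm_def V_def)
      qed
      then obtain v where v: "v \<in> V" "deriv_op_norm k f x - \<epsilon> < deriv_form k f x v"
        by blast
      \<comment> \<open>Being within \<epsilon> of the supremum is an open condition on the tuple,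
        so some member of the dense set T satisfies it as well.\<close>
      have "open {u. deriv_op_norm k f x - \<epsilon> < deriv_form k f x u}"
        using continuous_on_deriv_form_vectors by (intro open_Collect_less continuous_on_const)
      then obtain u where "u \<in> T" "deriv_op_norm k f x - \<epsilon> < deriv_form k f x u"
        using v T(3) closure_iff_nhds_not_empty[of v T] by blast
      then show "\<exists>j. deriv_op_norm k f x - \<epsilon> < \<bar>deriv_form k f x (e j)\<bar>"
        using ran by (metis abs_ge_self imageE less_le_trans)
    qed
  qed
qed

section \<open>Moment bounds for the operator norms\<close>

context weighted_poincare_space
begin

text \<open>The supremum runs over an uncountable set, but measurable soft maxima converge to it
  pointwise. Continuity of the forms is enough, so the top order d is included.\<close>

lemma deriv_op_norm_measurable:
  assumes f: "Cd_on d G f" and k: "1 \<le> k" "k \<le> d"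
  shows "deriv_op_norm k f \<in> borel_measurable \<mu>"
proof -
  obtain e where lim: "\<And>x. (\<lambda>n. log_mean_cosh (Suc n) (\<lambda>m. deriv_form k f x (e m))) \<longlonglongrightarrow> deriv_op_norm k f x"
    using deriv_op_norm_dense_sequence[OF k(1)] by metis
  have [measurable]: "(\<lambda>x. deriv_form k f x v) \<in> borel_measurable \<mu>" for v
    using f k(2) by (intro continuous_on_measurable continuous_on_deriv_form)
  show ?thesis
    by (rule borel_measurable_LIMSEQ_real[OF lim]) (simp add: log_mean_cosh_def cosh_field_def)
qed

text \<open>The soft maxima stay between 0 and the operator norm, which controls their L^2 norms,
  and their gradients obey one bound for all n. The estimate for C^1 functions thus has a right-hand
  side free of n and survives the limit.\<close>

lemma Lq_norm_deriv_op_norm_le: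
  assumes f: "Cd_on d G f" and k: "1 \<le> k" "k < d" and q: "2 \<le> q"
  shows "Lq_norm \<mu> q (deriv_op_norm k f) \<le> Lq_norm \<mu> 2 (deriv_op_norm k f)
    + ennreal (q / sqrt 2) * Lq_norm \<mu> q (\<lambda>x. w x * deriv_op_norm (Suc k) f x)"
proof -
  obtain e where e: "\<And>m j. j < k \<Longrightarrow> norm (e m j) = 1"
    and lim: "\<And>x. (\<lambda>n. log_mean_cosh (Suc n) (\<lambda>m. deriv_form k f x (e m))) \<longlonglongrightarrow> deriv_op_norm k f x"
    using deriv_op_norm_dense_sequence[OF k(1)] by metis
  define u where "u = (\<lambda>n x. log_mean_cosh (Suc n) (\<lambda>m. deriv_form k f x (e m)))"
  have C1: "Cd_on 1 G (u n)" for n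
    unfolding u_def using f k by (intro Cd_on_1_log_mean_cosh Cd_on_1_deriv_form) auto
  have W: "(\<lambda>x. w x * deriv_op_norm (Suc k) f x) \<in> borel_measurable \<mu>"
    using deriv_op_norm_measurable[OF f, of "Suc k"] k by simp
  have grad: "norm (gradient (u n) x) * w x \<le> w x * deriv_op_norm (Suc k) f x" if x: "x \<in> G" for n x
  proof -
    have "norm (gradient (u n) x) \<le> deriv_op_norm (Suc k) f x"
      unfolding u_def
    proof (rule norm_gradient_log_mean_cosh_le[OF _ _ x])
      show "Cd_on 1 G (\<lambda>x. deriv_form k f x (e j))" for j
        using f k by (intro Cd_on_1_deriv_form)
      show "norm (gradient (\<lambda>x. deriv_form k f x (e j)) x) \<le> deriv_op_norm (Suc k) f x" for j
        by (rule norm_gradient_deriv_form_le[OF f k(2) x e])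
    qed simp
    with w_nonneg[OF x] show ?thesis by (simp add: mult.commute mult_left_mono)
  qed
  show ?thesis
  proof (rule Lq_norm_Fatou[where u = u])
    show "u n \<in> borel_measurable \<mu>" for n
      using C1[of n] unfolding Cd_on_1_iff by (intro continuous_on_measurable) blast
    show "(\<lambda>n. u n x) \<longlonglongrightarrow> deriv_op_norm k f x" for x
      unfolding u_def by (rule lim)
    fix n
    have "u n x \<le> deriv_op_norm k f x" for x
      unfolding u_def using k(1) e by (intro log_mean_cosh_le abs_deriv_form_le_op_norm) auto
    moreover have "0 \<le> u n x" for x
      by (simp add: u_def log_mean_cosh_nonneg)
    ultimately have "\<bar>u n x\<bar> \<le> \<bar>deriv_op_norm k f x\<bar>" for x
      by (smt (verit))
    then have "Lq_norm \<mu> 2 (u n) \<le> Lq_norm \<mu> 2 (deriv_op_norm k f)"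
      by (intro Lq_norm_mono) auto
    with Lq_norm_le_L2_plus_gradient[OF C1 q W grad]
    show "Lq_norm \<mu> q (u n) \<le> Lq_norm \<mu> 2 (deriv_op_norm k f)
        + ennreal (q / sqrt 2) * Lq_norm \<mu> q (\<lambda>x. w x * deriv_op_norm (Suc k) f x)"
      by (meson add_right_mono order.trans)
  qed (use q in auto)
qed

text \<open>f is its own derivative form of order 0, hence C^1, and no smoothing is involved. Its
  mean vanishes, so the centred estimate applies without an L^2 term.\<close>

lemma Lq_norm_le_deriv_op_norm_1:
  assumes f: "Cd_on d G f" and d: "1 \<le> d" and p: "2 \<le> p"
    and int: "integrable \<mu> f" "(\<integral>x. f x \<partial>\<mu>) = 0"
  shows "Lq_norm \<mu> p f \<le> ennreal (p / sqrt 2) * Lq_norm \<mu> p (\<lambda>x. w x * deriv_op_norm 1 f x)"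
proof -
  have "Cd_on 1 G f"
    using Cd_on_1_deriv_form[OF f, of 0] d by simp
  moreover have "(\<lambda>x. w x * deriv_op_norm 1 f x) \<in> borel_measurable \<mu>"
    using deriv_op_norm_measurable[OF f, of 1] d by simp
  moreover have "norm (gradient f x) * w x \<le> w x * deriv_op_norm 1 f x" if x: "x \<in> G" for x
    using norm_gradient_deriv_form_le[OF f _ x, of 0] d w_nonneg[OF x]
    by (simp add: mult.commute mult_left_mono)
  ultimately show ?thesis
    using Lq_norm_centered_le_gradient[OF _ p int(1)] int(2) by simp
qed

end

section \<open>Iteration over the order of the derivative\<close>

text \<open>Exponent count for powers of 2: m (m - 2)/2 + m - 1/2 = (m + 1)(m - 1)/2. The factor 2^m
  p / sqrt 2 is the constant of the moment estimate at exponent 2^m p.\<close>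

lemma dyadic_constant_step:
  fixes p :: real
  shows "(2 powr ((real m - 2) / 2) * p) ^ m * (2 ^ m * p / sqrt 2) = (2 powr ((real (Suc m) - 2) / 2) * p) ^ Suc m"
proof -
  have pw: "(2 powr x) ^ k = 2 powr (x * real k)" for x :: real and k
    by (subst powr_realpow[symmetric]) (simp_all add: powr_powr)
  have "(2 powr ((real m - 2) / 2)) ^ m * (2 ^ m / sqrt 2)
      = (2 :: real) powr ((real m - 2) / 2 * real m + real m - 1 / 2)"
    unfolding pw powr_add powr_diff by (simp add: powr_realpow powr_half_sqrt)
  also have "(real m - 2) / 2 * real m + real m - 1 / 2 = (real (Suc m) - 2) / 2 * real (Suc m)"
    by (simp add: field_simps)
  also have "2 powr \<dots> = (2 powr ((real (Suc m) - 2) / 2)) ^ Suc m"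
    by (rule pw[symmetric])
  finally have exponents: "(2 powr ((real m - 2) / 2)) ^ m * (2 ^ m / sqrt 2)
      = ((2 :: real) powr ((real (Suc m) - 2) / 2)) ^ Suc m" .
  have "(2 powr ((real m - 2) / 2) * p) ^ m * (2 ^ m * p / sqrt 2)
      = ((2 powr ((real m - 2) / 2)) ^ m * (2 ^ m / sqrt 2)) * p ^ Suc m"
    by (simp add: power_mult_distrib)
  then show ?thesis
    unfolding exponents by (simp add: power_mult_distrib)
qed

theorem proposition1p4:
  fixes G :: "(real ^ 'n::finite) set"
    and \<mu> :: "(real ^ 'n) measure"
    and w f :: "real ^ 'n \<Rightarrow> real"
    and d :: nat and p :: real
  assumes "open G"
    and "prob_space \<mu>"
    and "sets \<mu> = sets (restrict_space borel G)"
    and "w \<in> borel_measurable \<mu>"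
    and "\<And>x. x \<in> G \<Longrightarrow> 0 \<le> w x"
    and "weighted_poincare G \<mu> w"
    and "d \<ge> 1"
    and "Cd_on d G f"
    and "integrable \<mu> f"
    and "(\<integral>x. f x \<partial>\<mu>) = 0"
    and "p \<ge> 2"
  shows "Lq_norm \<mu> p f \<le>
      (\<Sum>k\<in>{1..<d}. (ennreal (2 powr ((real k - 2) / 2) * p) * Lq_norm \<mu> (2 ^ k * p) w) ^ k
          * Lq_norm \<mu> 2 (deriv_op_norm k f))
      + ennreal (2 powr ((real d - 2) / 2) * p) ^ d * Lq_norm \<mu> (2 ^ (d - 1) * p) w ^ (d - 1)
          * Lq_norm \<mu> (2 ^ (d - 1) * p) (\<lambda>x. w x * deriv_op_norm d f x)
    \<and>
      (\<Sum>k\<in>{1..<d}. (ennreal (2 powr ((real k - 2) / 2) * p) * Lq_norm \<mu> (2 ^ k * p) w) ^ k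
          * Lq_norm \<mu> 2 (deriv_op_norm k f))
      + ennreal (2 powr ((real d - 2) / 2) * p) ^ d * Lq_norm \<mu> (2 ^ (d - 1) * p) w ^ (d - 1)
          * Lq_norm \<mu> (2 ^ (d - 1) * p) (\<lambda>x. w x * deriv_op_norm d f x)
    \<le>
      (\<Sum>k\<in>{1..<d}. (ennreal (2 powr ((real k - 2) / 2) * p) * Lq_norm \<mu> (2 ^ k * p) w) ^ k
          * Lq_norm \<mu> 2 (deriv_op_norm k f))
      + (ennreal (2 powr ((real d - 2) / 2) * p) * Lq_norm \<mu> (2 ^ d * p) w) ^ d
          * Lq_norm \<mu> (2 ^ d * p) (deriv_op_norm d f)"
proof -
  interpret weighted_poincare_space G \<mu> w
    by (intro weighted_poincare_space.intro weighted_poincare_space_axioms.intro assms)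
  define C where "C = (\<lambda>k. ennreal (2 powr ((real k - 2) / 2) * p))"
  define a where "a = (\<lambda>k. Lq_norm \<mu> (2 ^ k * p) w)"
  define N where "N = (\<lambda>k. Lq_norm \<mu> (2 ^ k * p) (deriv_op_norm k f))"
  define N2 where "N2 = (\<lambda>k. Lq_norm \<mu> 2 (deriv_op_norm k f))"
  \<comment> \<open>The remainder: the weight is still attached to the k-th derivative, at half the
    exponent used in \<open>N k\<close>.\<close>
  define T where "T = (\<lambda>k. Lq_norm \<mu> (2 ^ (k - 1) * p) (\<lambda>x. w x * deriv_op_norm k f x))"
  have a_mono: "a j \<le> a k" if "j \<le> k" for j k
    unfolding a_def using \<open>p \<ge> 2\<close> that by (intro Lq_norm_dyadic_mono) auto
  have T_le: "T k \<le> a k * N k" if "1 \<le> k" "k \<le> d" for k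
  proof -
    have double: "2 * (2 ^ (k - 1) * p) = 2 ^ k * p" using that by (cases k) auto
    then show ?thesis
      using Lq_norm_mult_le[OF w_measurable deriv_op_norm_measurable[OF \<open>Cd_on d G f\<close> that], of "2 ^ (k - 1) * p"] \<open>p \<ge> 2\<close>
      unfolding T_def a_def N_def double by simp
  qed
  have N_le: "N k \<le> N2 k + ennreal (2 ^ k * p / sqrt 2) * T (Suc k)" if "1 \<le> k" "k < d" for k
  proof -
    \<comment> \<open>The moment estimate demands an exponent of at least 2.\<close>
    have "1 * 2 \<le> 2 ^ k * p" using \<open>p \<ge> 2\<close> by (intro mult_mono) auto
    then show ?thesis
      using Lq_norm_deriv_op_norm_le[OF \<open>Cd_on d G f\<close> that, of "2 ^ k * p"]
      by (simp add: N_def N2_def T_def)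
  qed
  \<comment> \<open>The iteration stopped at order m: the sum holds the L^2 norms already released,
    and \<open>T m\<close> is what remains. For m = d this is the first inequality.\<close>
  have bound: "Lq_norm \<mu> p f \<le> (\<Sum>k\<in>{1..<m}. (C k * a k) ^ k * N2 k) + C m ^ m * a (m - 1) ^ (m - 1) * T m"
    if "1 \<le> m" "m \<le> d" for m
    using that
  proof (induction m rule: dec_induct)
    case base
    \<comment> \<open>For m = 1 the sum is empty and the power of \<open>a 0\<close> is 1, so only
      the constant 2^(-1/2) p = p / sqrt 2 has to be recognised.\<close>
    have "(2 :: real) powr - (1 / 2) = 1 / sqrt 2"
      unfolding powr_minus_divide by (simp add: powr_half_sqrt)
    then have "2 powr ((real 1 - 2) / 2) * p = p / sqrt 2" by simp
    then show ?case
      using Lq_norm_le_deriv_op_norm_1[OF \<open>Cd_on d G f\<close> \<open>d \<ge> 1\<close> \<open>p \<ge> 2\<close> assms(9,10)]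
      by (simp add: C_def T_def)
  next
    case (step m)
    \<comment> \<open>Raising the exponent of the m - 1 older factors of w to 2^m p lets them merge
      with the factor freshly split off from \<open>T m\<close>; the operator norm left behind is
      traded for its L^2 norm and the next remainder.\<close>
    have "C m ^ m * a (m - 1) ^ (m - 1) * T m
        \<le> C m ^ m * a m ^ (m - 1) * (a m * (N2 m + ennreal (2 ^ m * p / sqrt 2) * T (Suc m)))"
      using step.hyps step.prems
      by (intro mult_mono power_mono a_mono order.trans[OF T_le] N_le) auto
    also have "\<dots> = C m ^ m * (a m ^ (m - 1) * a m) * N2 m
        + C m ^ m * ennreal (2 ^ m * p / sqrt 2) * (a m ^ (m - 1) * a m) * T (Suc m)"
      by (simp add: distrib_left ac_simps)
    also have "a m ^ (m - 1) * a m = a m ^ m"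
      using step.hyps by (intro power_minus_mult) simp
    also have "C m ^ m * ennreal (2 ^ m * p / sqrt 2) = C (Suc m) ^ Suc m"
      using dyadic_constant_step[of m p] \<open>p \<ge> 2\<close>
      by (simp add: C_def ennreal_power flip: ennreal_mult)
    finally have "C m ^ m * a (m - 1) ^ (m - 1) * T m
        \<le> (C m * a m) ^ m * N2 m + C (Suc m) ^ Suc m * a m ^ m * T (Suc m)"
      by (simp add: power_mult_distrib)
    then have "(\<Sum>k\<in>{1..<m}. (C k * a k) ^ k * N2 k) + C m ^ m * a (m - 1) ^ (m - 1) * T m
        \<le> (\<Sum>k\<in>{1..<m}. (C k * a k) ^ k * N2 k)
          + ((C m * a m) ^ m * N2 m + C (Suc m) ^ Suc m * a m ^ m * T (Suc m))"
      by (rule add_left_mono)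
    from order.trans[OF step.IH this] step.prems
    have "Lq_norm \<mu> p f \<le> (\<Sum>k\<in>{1..<m}. (C k * a k) ^ k * N2 k)
        + ((C m * a m) ^ m * N2 m + C (Suc m) ^ Suc m * a m ^ m * T (Suc m))"
      by simp
    then show ?case
      using step.hyps by (simp add: sum.atLeastLessThan_Suc add.assoc)
  qed
  \<comment> \<open>For the second inequality the weight is split off once more, at order d, with no
    further derivative.\<close>
  have "C d ^ d * a (d - 1) ^ (d - 1) * T d \<le> C d ^ d * a d ^ (d - 1) * (a d * N d)"
    using \<open>d \<ge> 1\<close> by (intro mult_mono power_mono a_mono T_le) auto
  also have "\<dots> = C d ^ d * (a d ^ (d - 1) * a d) * N d"
    by (simp add: ac_simps)
  also have "a d ^ (d - 1) * a d = a d ^ d"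
    using \<open>d \<ge> 1\<close> by (intro power_minus_mult) simp
  finally have "C d ^ d * a (d - 1) ^ (d - 1) * T d \<le> (C d * a d) ^ d * N d"
    by (simp add: power_mult_distrib)
  then have "(\<Sum>k\<in>{1..<d}. (C k * a k) ^ k * N2 k) + C d ^ d * a (d - 1) ^ (d - 1) * T d
      \<le> (\<Sum>k\<in>{1..<d}. (C k * a k) ^ k * N2 k) + (C d * a d) ^ d * N d"
    by (rule add_left_mono)
  with bound[OF \<open>d \<ge> 1\<close> order.refl] show ?thesis
    unfolding C_def a_def N_def N2_def T_def by (rule conjI)
qed

end
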